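(* Let $\alpha\in(0,1)$, $\varepsilon\in(0,1)$, an integer $m\ge1$ and the density $\nu$ be fixed, and let $\mathbf{A}=\{A_h,\,h\in\mathcal{H}\}$ be amplitudes $A_h>0$ (which may depend on $\omega$). (i) If for some $x\in\mathbb{R}$ and $\eta>0$ $$\lim_{\omega\to\infty}\frac{1}{\log^*(\omega)}\mathbf{E}_{\bar{\pi}^{\omega,\nu}}\Bigl[\Bigl(\frac{A_h}{\sigma_h}-x\Bigr)^2+\eta\log^*(\omega)-R_h^+(q_\alpha^\varkappa,\omega)\Bigr]_+=0,$$ then $$\liminf_{\omega\to\infty}\bar{\beta}^{\Pi}_{\bar{\pi}^{\omega,\nu}}(\mathbf{A})\ge(1-\alpha)[1-\Phi(x)].$$ (ii) If for some $\eta>0$ $$\lim_{\omega\to\infty}\frac{1}{\log^*(\omega)}\mathbf{E}_{\bar{\pi}^{\omega,\nu}}\Bigl[R_h^+(q_\alpha^\varkappa,\omega)+2\sqrt{\eta\log^*(\omega)}\,\frac{A_h}{\sigma_h}-\frac{A_h^2}{\sigma_h^2}\Bigr]_+=0,$$ then $$\lim_{\omega\to\infty}\bar{\beta}^{\Pi}_{\bar{\pi}^{\omega,\nu}}(\mathbf{A})=0.$$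
   Context: Model. $\mathcal{H}=\{1/2,1/4,\ldots,2^{-k},\ldots\}$; for $h\in\mathcal{H}$, $\mathcal{G}_h=\{h,3h,\ldots,1-h\}$ and $n_h=1/(2h)=|\mathcal{G}_h|$. One observes $\hat\theta_{h,t}=\theta_{h,t}+\sigma_h\xi_{h,t}$, $h\in\mathcal{H}$, $t\in\mathcal{G}_h$, where $\sigma_h=\sigma\sqrt{2/h}$ with known fixed $\sigma>0$, the $\xi_{h,t}$ are i.i.d. $\mathcal{N}(0,1)$ and $\Theta=\{\theta_{h,t}\}$ is an unknown array of reals; $\mathbf{P}_\Theta$ is the law of the observations. $\Phi$ is the standard Gaussian distribution function and $S(x)=\frac1{\Phi(x)}-1$. Adaptive test. Let $\psi_0(x)=1+\log(x)$ and $\psi_l(x)=\psi_0[\psi_{l-1}(x)]$, $l=1,\ldots,m$. Define the probability distribution $\Pi$ on $\mathcal{H}$ by $$\Pi_h=\frac1{\{\psi_m[\log_2(1/h)]\}^\varepsilon}-\frac1{\{\psi_m[\log_2(1/h)+1]\}^\varepsilon},\quad h\in\mathcal{H}.$$ Let $q_\alpha^\varkappa=-\log\bigl(\log\frac1{1-\alpha}\bigr)$ and $Z_h^M=\max_{t\in\mathcal{G}_h}\log\bigl[\frac1{n_h}S(\hat\theta_{h,t}/\sigma_h)\bigr]$. The test rejects the null hypothesis (all $\theta_{h,t}\ge0$) if $\sup_{h\in\mathcal{H}}\{Z_h^M+\log\Pi_h\}\ge q_\alpha^\varkappa$. Priors. For $\omega>1$, $$\bar\pi_h^{\omega,\nu}=\nu\Bigl[\frac{\log_2(1/h)}{\omega}\Bigr]\Big/\sum_{k=1}^\infty\nu\Bigl(\frac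 k\omega\Bigr),\quad h\in\mathcal{H},$$ where $\nu$ is a probability density on $\mathbb{R}^+$ which is continuous, bounded and satisfies $H_\nu=\int_0^\infty\nu(x)\log\frac1{\nu(x)}dx<\infty$ and $\int_0^\infty\nu(x)\log(x+1)\,dx<\infty$; for the values of $\omega$ considered, $\bar\pi^{\omega,\nu}$ is a well-defined probability distribution on $\mathcal{H}$ with finite entropy. Type II errors. For $\rho\in\mathcal{H}$, $\tau\in\mathcal{G}_\rho$, $A>0$ let $\Theta_{\rho,\tau}(A)$ be the set of arrays $\{\theta_{h,t}\}$ with $\theta_{\rho,\tau}=-A$ and $\theta_{h,t}\ge0$ for all $(h,t)\ne(\rho,\tau)$. Put $$\beta^\Pi_{\rho,\tau}(A)=\sup_{\Theta\in\Theta_{\rho,\tau}(A)}\mathbf{P}_\Theta\Bigl\{\sup_{h\in\mathcal{H}}[Z_h^M+\log\Pi_h]\le q_\alpha^\varkappa\Bigr\},\qquad \bar\beta^\Pi_{\bar\pi^{\omega,\nu}}(\mathbf{A})=\sum_{h\in\mathcal{H}}\frac{\bar\pi_h^{\omega,\nu}}{n_h}\sum_{t\in\mathcal{G}_h}\beta^\Pi_{h,t}(A_h).$$ Notation. $\log^*(x)=\log[\log(x)]$; $\mathbf{E}_{\bar\pi}[f_h]=\sum_{h\in\mathcal{H}}\bar\pi_hf_h$; $[y]_+=\max(y,0)$; and (with $\pi$ without a bar the usual constant) $$\widetilde R_h(q,\omega)=2[q+\log(n_h)+\log(\omega)]-\log[4\pi(q+\log(n_h)+\log(\omega))],\qquad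 R_h^+(q,\omega)=\widetilde R_h(q,\omega)+\log^*(\omega),$$ which are well defined for $\omega$ large enough. *)

theory Defs
  imports "HOL-Probability.Probability"
begin

section \<open>The observation model\<close>

definition scales :: "real set" where
  "scales = {h. \<exists>k::nat. 1 \<le> k \<and> h = (1 / 2) ^ k}"

definition grid :: "real \<Rightarrow> real set" where
  "grid h = {t. \<exists>i::nat. t = (2 * real i + 1) * h \<and> t \<le> 1 - h}"

definition grid_size :: "real \<Rightarrow> real" where
  "grid_size h = 1 / (2 * h)"

lemma finite_card_grid:
  assumes "h \<in> scales"
  shows "finite (grid h)" "real (card (grid h)) = grid_size h"
proof -
  from assms obtain k :: nat where k: "1 \<le> k" "h = (1 / 2) ^ k"
    by (auto simp: scales_def)
  then obtain j where j: "k = Suc j"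
    by (cases k) auto
  have h: "h > 0" and hj: "2 * h * 2 ^ j = 1"
    using k j by (auto simp: power_divide)
  have iff: "(2 * real i + 1) * h \<le> 1 - h \<longleftrightarrow> i < 2 ^ j" for i :: nat
  proof -
    have "(2 * real i + 1) * h \<le> 1 - h \<longleftrightarrow> 2 * h * (real i + 1) \<le> 2 * h * 2 ^ j"
      unfolding hj by (simp add: algebra_simps)
    also have "\<dots> \<longleftrightarrow> real i + 1 \<le> 2 ^ j"
      using h by simp
    also have "\<dots> \<longleftrightarrow> real (i + 1) \<le> real (2 ^ j)"
      by (simp add: add.commute)
    also have "\<dots> \<longleftrightarrow> i < 2 ^ j"
      unfolding of_nat_le_iff by linarith
    finally show ?thesis .
  qed
  have grid: "grid h = (\<lambda>i. (2 * real i + 1) * h) ` {..<2 ^ j}"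
    using iff by (auto simp: grid_def)
  then show "finite (grid h)"
    by simp
  have "inj_on (\<lambda>i. (2 * real i + 1) * h) {..<2 ^ j}"
    using h by (auto simp: inj_on_def)
  then have "real (card (grid h)) = 2 ^ j"
    unfolding grid by (simp add: card_image)
  also have "\<dots> = grid_size h"
    using h hj by (simp add: grid_size_def field_simps)
  finally show "real (card (grid h)) = grid_size h" .
qed

text \<open>Arrays \<open>\<theta>\<^bsub>h,t\<^esub>\<close> are functions on pairs; only their values on \<open>indices\<close> matter.\<close>

definition indices :: "(real \<times> real) set" where
  "indices = Sigma scales grid"

definition noise_level :: "real \<Rightarrow> real \<Rightarrow> real" where
  "noise_level \<sigma> h = \<sigma> * sqrt (2 / h)"

definition noise_law :: "(real \<times> real \<Rightarrow> real) measure" where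
  "noise_law = PiM indices (\<lambda>_. std_normal_distribution)"

definition observation_law ::
  "real \<Rightarrow> (real \<times> real \<Rightarrow> real) \<Rightarrow> (real \<times> real \<Rightarrow> real) measure" where
  "observation_law \<sigma> \<Theta> =
     distr noise_law (PiM indices (\<lambda>_. borel))
       (\<lambda>\<xi>. \<lambda>i\<in>indices. \<Theta> i + noise_level \<sigma> (fst i) * \<xi> i)"


section \<open>The adaptive test\<close>

definition Phi :: "real \<Rightarrow> real" where
  "Phi x = cdf std_normal_distribution x"

definition S :: "real \<Rightarrow> real" where
  "S x = 1 / Phi x - 1"

primrec psi :: "nat \<Rightarrow> real \<Rightarrow> real" where
  "psi 0 x = 1 + ln x"
| "psi (Suc l) x = 1 + ln (psi l x)"

definition Pi_weight :: "nat \<Rightarrow> real \<Rightarrow> real \<Rightarrow> real" where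
  "Pi_weight m \<epsilon> h =
     1 / psi m (log 2 (1 / h)) powr \<epsilon> - 1 / psi m (log 2 (1 / h) + 1) powr \<epsilon>"

definition threshold :: "real \<Rightarrow> real" where
  "threshold \<alpha> = - ln (ln (1 / (1 - \<alpha>)))"

definition Z_max :: "real \<Rightarrow> (real \<times> real \<Rightarrow> real) \<Rightarrow> real \<Rightarrow> real" where
  "Z_max \<sigma> y h = Max ((\<lambda>t. ln (S (y (h, t) / noise_level \<sigma> h) / grid_size h)) ` grid h)"

text \<open>The supremum over the infinitely many scales may be infinite, hence the type \<open>ereal\<close>.\<close>

definition test_statistic :: "real \<Rightarrow> nat \<Rightarrow> real \<Rightarrow> (real \<times> real \<Rightarrow> real) \<Rightarrow> ereal" where
  "test_statistic \<sigma> m \<epsilon> y = (SUP h\<in>scales. ereal (Z_max \<sigma> y h + ln (Pi_weight m \<epsilon> h)))"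


section \<open>Type II errors\<close>

definition alternatives :: "real \<Rightarrow> real \<Rightarrow> real \<Rightarrow> (real \<times> real \<Rightarrow> real) set" where
  "alternatives \<rho> \<tau> a =
     {\<Theta>. \<Theta> (\<rho>, \<tau>) = - a \<and> (\<forall>i\<in>indices. i \<noteq> (\<rho>, \<tau>) \<longrightarrow> 0 \<le> \<Theta> i)}"

definition type_II_error ::
  "real \<Rightarrow> nat \<Rightarrow> real \<Rightarrow> real \<Rightarrow> real \<Rightarrow> real \<Rightarrow> real \<Rightarrow> real" where
  "type_II_error \<sigma> m \<epsilon> \<alpha> \<rho> \<tau> a =
     (SUP \<Theta>\<in>alternatives \<rho> \<tau> a.
        measure (observation_law \<sigma> \<Theta>)
          {y \<in> space (observation_law \<sigma> \<Theta>). test_statistic \<sigma> m \<epsilon> y \<le> ereal (threshold \<alpha>)})"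

definition mean_type_II_error ::
  "real \<Rightarrow> nat \<Rightarrow> real \<Rightarrow> real \<Rightarrow> (real \<Rightarrow> real) \<Rightarrow> (real \<Rightarrow> real) \<Rightarrow> real" where
  "mean_type_II_error \<sigma> m \<epsilon> \<alpha> p A =
     (\<Sum>\<^sub>\<infinity>h\<in>scales. p h / grid_size h * (\<Sum>t\<in>grid h. type_II_error \<sigma> m \<epsilon> \<alpha> h t (A h)))"


section \<open>Priors on the scales\<close>

definition prior :: "(real \<Rightarrow> real) \<Rightarrow> real \<Rightarrow> real \<Rightarrow> real" where
  "prior \<nu> \<omega> h = \<nu> (log 2 (1 / h) / \<omega>) / (\<Sum>k. \<nu> (real (Suc k) / \<omega>))"

text \<open>With \<open>ln (1 / 0) = 0\<close> the usual convention \<open>0 log (1 / 0) = 0\<close> is built in. Since \<open>\<nu>\<close> is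
  bounded, the negative part of \<open>\<nu> log (1 / \<nu>)\<close> is integrable, so that \<open>H\<^sub>\<nu> < \<infinity>\<close> amounts to
  integrability.\<close>

definition admissible_density :: "(real \<Rightarrow> real) \<Rightarrow> bool" where
  "admissible_density \<nu> \<longleftrightarrow>
     (\<forall>x>0. 0 \<le> \<nu> x) \<and>
     set_integrable lborel {0<..} \<nu> \<and> (LINT x:{0<..}|lborel. \<nu> x) = 1 \<and>
     continuous_on {0<..} \<nu> \<and>
     (\<exists>C. \<forall>x>0. \<nu> x \<le> C) \<and>
     set_integrable lborel {0<..} (\<lambda>x. \<nu> x * ln (1 / \<nu> x)) \<and>
     set_integrable lborel {0<..} (\<lambda>x. \<nu> x * ln (x + 1))"

definition prob_dist_finite_entropy :: "(real \<Rightarrow> real) \<Rightarrow> bool" where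
  "prob_dist_finite_entropy p \<longleftrightarrow>
     (\<forall>h\<in>scales. 0 \<le> p h) \<and> (p has_sum 1) scales \<and>
     (\<lambda>h. p h * ln (1 / p h)) summable_on scales"

text \<open>Expectation of the positive part. It is extended-valued because nothing prevents it from being
  infinite; a real-valued sum would then silently be \<open>0\<close>.\<close>

definition expectation_pos_part :: "(real \<Rightarrow> real) \<Rightarrow> (real \<Rightarrow> real) \<Rightarrow> ennreal" where
  "expectation_pos_part p f =
     (\<integral>\<^sup>+h. ennreal (p h) * ennreal (max (f h) 0) \<partial>count_space scales)"


section \<open>Detection radii\<close>

definition log_star :: "real \<Rightarrow> real" where
  "log_star x = ln (ln x)"

definition R_tilde :: "real \<Rightarrow> real \<Rightarrow> real \<Rightarrow> real" where
  "R_tilde q \<omega> h =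
     2 * (q + ln (grid_size h) + ln \<omega>) - ln (4 * pi * (q + ln (grid_size h) + ln \<omega>))"

definition R_plus :: "real \<Rightarrow> real \<Rightarrow> real \<Rightarrow> real" where
  "R_plus q \<omega> h = R_tilde q \<omega> h + log_star \<omega>"

end

theory Submission
  imports Defs "HOL-Real_Asymp.Real_Asymp"
begin

text \<open>A single number per scale governs everything. The test accepts iff every standardized observation
  \<open>y (h, t) / \<sigma>\<^sub>h\<close> stays above \<open>- u\<^sub>h\<close>, where the critical value \<open>u\<^sub>h\<close> is the upper Gaussian quantile of
  level \<open>1 / (1 + n\<^sub>h e\<^sup>q / \<Pi>\<^sub>h)\<close> (lemma \<open>test_accepts_iff\<close>). In the supremum that defines the type II
  error the means off \<open>(h, t)\<close> can be pushed to infinity, so the other coordinates stop causing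
  rejections, and the supremum equals \<open>Phi (u\<^sub>h - A\<^sub>h / \<sigma>\<^sub>h)\<close> (lemma \<open>type_II_error_eq\<close>). It remains to
  compare \<open>A\<^sub>h / \<sigma>\<^sub>h\<close> with \<open>u\<^sub>h\<close> at typical scales.

  Gaussian tails give \<open>u\<^sub>h\<^sup>2 \<approx> 2 log (n\<^sub>h e\<^sup>q / \<Pi>\<^sub>h)\<close>, while \<open>R_plus \<approx> 2 log (n\<^sub>h e\<^sup>q \<omega>)\<close>, both up to
  doubly logarithmic terms. The two differ by \<open>2 log (1 / \<Pi>\<^sub>h) - 2 log \<omega>\<close>, which is logarithmic in
  \<open>log n\<^sub>h\<close> and in \<open>\<omega>\<close>. Under the prior, \<open>log\<^sub>2 (1 / h)\<close> exceeds \<open>sqrt \<omega>\<close> with probability tending to 1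
  (lemma \<open>prior_coarse_scales\<close>); then \<open>R_plus \<ge> log n\<^sub>h\<close> is so large that such a difference changes the
  square root only by \<open>o(1)\<close>. So \<open>u\<^sub>h\<close> is at least \<open>sqrt R_plus - o(1)\<close> and at most \<open>sqrt R_plus + 1\<close>
  (lemma \<open>critical_value_asymptotics\<close>).

  By Markov's inequality the hypothesis of (i) yields \<open>A\<^sub>h / \<sigma>\<^sub>h \<le> x + sqrt R_plus\<close>, and that of (ii)
  yields \<open>A\<^sub>h / \<sigma>\<^sub>h \<ge> sqrt R_plus + sqrt (\<eta> log_star \<omega>)\<close>, off a set of scales of vanishing mass
  (lemma \<open>exceedance_mass_vanishes\<close>). The error at the remaining scales is therefore at least
  \<open>Phi (- x - o(1))\<close>, which tends to \<open>1 - Phi x\<close>, in case (i), and at most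
  \<open>Phi (1 - sqrt (\<eta> log_star \<omega>))\<close>, which tends to 0, in case (ii).\<close>

section \<open>The Gaussian distribution function\<close>

abbreviation \<phi> :: "real \<Rightarrow> real" where "\<phi> \<equiv> std_normal_density"

interpretation std_normal: real_distribution std_normal_distribution
  by (rule real_dist_normal_dist)

lemma emeasure_std_normal:
  assumes "B \<in> sets borel"
  shows "emeasure std_normal_distribution B = (\<integral>\<^sup>+x. ennreal (\<phi> x) * indicator B x \<partial>lborel)"
  using assms by (simp add: emeasure_density)

lemma std_normal_reflect:
  assumes [measurable]: "B \<in> sets borel"
  shows "measure std_normal_distribution (uminus -` B) = measure std_normal_distribution B"
proof -
  have [measurable]: "uminus -` B \<in> sets borel"
    using measurable_sets[of uminus borel borel B] by simp
  have "(\<integral>\<^sup>+x. ennreal (\<phi> x) * indicator B x \<partial>lborel)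
      = ennreal \<bar>-1\<bar> * (\<integral>\<^sup>+x. ennreal (\<phi> (0 + (-1) * x)) * indicator B (0 + (-1) * x) \<partial>lborel)"
    by (rule nn_integral_real_affine) auto
  also have "\<dots> = (\<integral>\<^sup>+x. ennreal (\<phi> x) * indicator (uminus -` B) x \<partial>lborel)"
    by (auto simp: std_normal_density_def indicator_def intro!: nn_integral_cong)
  finally have "emeasure std_normal_distribution (uminus -` B) = emeasure std_normal_distribution B"
    by (simp add: emeasure_std_normal)
  then show ?thesis
    by (simp add: measure_def)
qed

lemma Phi_eq_measure: "Phi x = measure std_normal_distribution {..x}"
  by (simp add: Phi_def cdf_def)

lemma std_normal_point: "measure std_normal_distribution {x} = 0"
  by (simp add: measure_def emeasure_std_normal nn_integral_indicator_singleton)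

lemma std_normal_atLeast: "measure std_normal_distribution {x..} = Phi (- x)"
proof -
  have "uminus -` {..- x} = {x..}"
    by auto
  then show ?thesis
    using std_normal_reflect[of "{..- x}"] by (simp add: Phi_eq_measure)
qed

lemma std_normal_lessThan: "measure std_normal_distribution {..<x} = 1 - Phi (- x)"
proof -
  have "{..<x} = space std_normal_distribution - {x..}"
    by auto
  then show ?thesis
    using std_normal.prob_compl[of "{x..}"] by (simp add: std_normal_atLeast)
qed

lemma isCont_Phi: "isCont Phi x"
  using std_normal.isCont_cdf[of x] by (simp add: std_normal_point Phi_def[abs_def])

lemma Phi_uminus: "Phi (- x) = 1 - Phi x"
proof -
  have "{..x} = {..<x} \<union> {x}"
    by auto
  then have "Phi x = measure std_normal_distribution {..<x} + measure std_normal_distribution {x}"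
    unfolding Phi_eq_measure by (simp only:) (rule std_normal.finite_measure_Union; simp)
  then show ?thesis
    by (simp add: std_normal_lessThan std_normal_point)
qed

lemma Phi_mono: "x \<le> y \<Longrightarrow> Phi x \<le> Phi y"
  unfolding Phi_def by (rule std_normal.cdf_nondecreasing)

lemma Phi_at_top: "(Phi \<longlongrightarrow> 1) at_top"
  using std_normal.cdf_lim_at_top_prob by (simp add: Phi_def[abs_def])

lemma Phi_at_bot: "(Phi \<longlongrightarrow> 0) at_bot"
  using std_normal.cdf_lim_at_bot by (simp add: Phi_def[abs_def])

lemma Phi_le_1: "Phi x \<le> 1"
  unfolding Phi_def by (rule std_normal.cdf_bounded_prob)

text \<open>The density is at least \<open>\<phi> c\<close> throughout \<open>[-c, c]\<close>. This single estimate yields strict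
  monotonicity as well as the lower tail bound.\<close>

lemma Phi_increment:
  assumes "a < b" "- c \<le> a" "b \<le> c"
  shows "(b - a) * \<phi> c \<le> Phi b - Phi a"
proof -
  have dens: "\<phi> c \<le> \<phi> x" if "x \<in> {a<..b}" for x
  proof -
    have "\<bar>x\<bar> \<le> \<bar>c\<bar>"
      using that assms by auto
    then have "x\<^sup>2 \<le> c\<^sup>2"
      by (simp add: abs_le_square_iff)
    then show ?thesis
      by (simp add: std_normal_density_def divide_right_mono)
  qed
  have "ennreal ((b - a) * \<phi> c) = (\<integral>\<^sup>+x. ennreal (\<phi> c) * indicator {a<..b} x \<partial>lborel)"
    using assms by (simp add: nn_integral_cmult_indicator ennreal_mult mult.commute)
  also have "\<dots> \<le> (\<integral>\<^sup>+x. ennreal (\<phi> x) * indicator {a<..b} x \<partial>lborel)"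
    using dens by (intro nn_integral_mono) (auto simp: indicator_def intro!: ennreal_leI)
  also have "\<dots> = emeasure std_normal_distribution {a<..b}"
    by (rule emeasure_std_normal[symmetric]) simp
  also have "\<dots> = ennreal (Phi b - Phi a)"
    using assms std_normal.cdf_diff_eq[of a b]
    by (simp add: Phi_def std_normal.emeasure_eq_measure)
  finally show ?thesis
    using Phi_mono[of a b] assms by (simp add: ennreal_le_iff)
qed

lemma Phi_strict_mono:
  assumes "a < b"
  shows "Phi a < Phi b"
proof -
  have "0 < (b - a) * \<phi> (max (- a) b)"
    using assms by (intro mult_pos_pos normal_density_pos) auto
  also have "\<dots> \<le> Phi b - Phi a"
    using assms by (intro Phi_increment) auto
  finally show ?thesis
    by simp
qed

lemma Phi_pos: "0 < Phi x"
proof -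
  have "0 \<le> Phi (x - 1)"
    unfolding Phi_def by (rule std_normal.cdf_nonneg)
  also have "\<dots> < Phi x"
    by (rule Phi_strict_mono) simp
  finally show ?thesis .
qed

lemma Phi_le_iff: "Phi a \<le> Phi b \<longleftrightarrow> a \<le> b"
  using Phi_mono[of a b] Phi_strict_mono[of b a] by linarith

text \<open>The mass of an interval of fixed length \<open>d\<close> suffices as a lower bound: it costs a shift of the
  quantile by \<open>d\<close>, and \<open>d\<close> can be made small afterwards. For negative \<open>u\<close>, the interval ends at 0.\<close>

lemma Phi_lower_tail:
  assumes "0 < d"
  shows "d * \<phi> (max 0 u + d) \<le> Phi (- u)"
proof -
  have "d * \<phi> (max 0 u + d) \<le> Phi (- max 0 u) - Phi (- max 0 u - d)"
    using Phi_increment[of "- max 0 u - d" "- max 0 u" "max 0 u + d"] assms by simp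
  also have "\<dots> \<le> Phi (- u)"
    using Phi_pos[of "- max 0 u - d"] Phi_mono[of "- max 0 u" "- u"] by simp
  finally show ?thesis .
qed

text \<open>Translating the half-line to \<open>x \<le> 0\<close> multiplies the density by
  \<open>exp (x u - u\<^sup>2 / 2)\<close>, which is at most \<open>exp (- u\<^sup>2 / 2)\<close>.\<close>

lemma Phi_upper_tail:
  assumes "0 \<le> u"
  shows "Phi (- u) \<le> exp (- u\<^sup>2 / 2)"
proof -
  have dens: "\<phi> (x - u) \<le> exp (- u\<^sup>2 / 2) * \<phi> x" if "x \<le> 0" for x
  proof -
    have "- (x - u)\<^sup>2 / 2 \<le> - u\<^sup>2 / 2 + - x\<^sup>2 / 2"
      using mult_nonpos_nonneg[OF that assms] by (simp add: power2_eq_square field_simps)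
    then have "exp (- (x - u)\<^sup>2 / 2) \<le> exp (- u\<^sup>2 / 2) * exp (- x\<^sup>2 / 2)"
      by (simp flip: exp_add)
    then show ?thesis
      by (simp add: std_normal_density_def divide_right_mono)
  qed
  have "ennreal (Phi (- u)) = (\<integral>\<^sup>+x. ennreal (\<phi> x) * indicator {..- u} x \<partial>lborel)"
    unfolding Phi_eq_measure std_normal.emeasure_eq_measure[symmetric]
    by (rule emeasure_std_normal) simp
  also have "\<dots> = ennreal \<bar>1\<bar> *
      (\<integral>\<^sup>+x. ennreal (\<phi> (- u + 1 * x)) * indicator {..- u} (- u + 1 * x) \<partial>lborel)"
    by (rule nn_integral_real_affine) auto
  also have "\<dots> \<le> (\<integral>\<^sup>+x. ennreal (exp (- u\<^sup>2 / 2)) * ennreal (\<phi> x) \<partial>lborel)"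
    using dens by (auto simp: indicator_def ennreal_mult[symmetric] intro!: nn_integral_mono ennreal_leI)
  also have "\<dots> = ennreal (exp (- u\<^sup>2 / 2))"
    using std_normal.emeasure_space_1 emeasure_std_normal[of UNIV] by (simp add: nn_integral_cmult)
  finally show ?thesis
    by (simp add: ennreal_le_iff)
qed

definition upper_quantile :: "real \<Rightarrow> real" where
  "upper_quantile p = (SOME u. Phi (- u) = p)"

lemma Phi_upper_quantile:
  assumes "0 < p" "p < 1"
  shows "Phi (- upper_quantile p) = p"
proof -
  have "\<forall>\<^sub>F x in at_bot. Phi x < p"
    using order_tendstoD(2)[OF Phi_at_bot] assms by simp
  then obtain a where a: "Phi a < p"
    using eventually_happens[of _ at_bot] by force
  have "\<forall>\<^sub>F x in at_top. p < Phi x"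
    using order_tendstoD(1)[OF Phi_at_top] assms by simp
  then obtain b where b: "p < Phi b"
    using eventually_happens[of _ at_top] by force
  have "Phi a \<le> Phi b"
    using a b by simp
  then have "a \<le> b"
    by (simp add: Phi_le_iff)
  then obtain x where "Phi x = p"
    using IVT[of Phi a p b] a b isCont_Phi by force
  then have "Phi (- (- x)) = p"
    by simp
  then show ?thesis
    unfolding upper_quantile_def by (rule someI)
qed

section \<open>Non-rejection in a single coordinate\<close>

text \<open>By monotonicity of \<open>S\<close>, the coordinate \<open>(h, t)\<close> does not trigger a rejection as long as
  \<open>S (y (h, t) / \<sigma>\<^sub>h) \<le> n\<^sub>h e\<^sup>q / \<Pi>\<^sub>h\<close>; by the definition of \<open>S\<close> this says that \<open>Phi\<close> is at least
  \<open>1 / (1 + n\<^sub>h e\<^sup>q / \<Pi>\<^sub>h)\<close> there. The critical value is the corresponding upper quantile.\<close>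

definition score_bound :: "nat \<Rightarrow> real \<Rightarrow> real \<Rightarrow> real \<Rightarrow> real" where
  "score_bound m \<epsilon> \<alpha> h = grid_size h * exp (threshold \<alpha>) / Pi_weight m \<epsilon> h"

definition critical_value :: "nat \<Rightarrow> real \<Rightarrow> real \<Rightarrow> real \<Rightarrow> real" where
  "critical_value m \<epsilon> \<alpha> h = upper_quantile (1 / (1 + score_bound m \<epsilon> \<alpha> h))"

lemma psi_ge_1: "1 \<le> x \<Longrightarrow> 1 \<le> psi l x"
  by (induction l) auto

lemma psi_le: "1 \<le> x \<Longrightarrow> psi l x \<le> x"
proof (induction l)
  case 0
  then show ?case using ln_le_minus_one[of x] by simp
next
  case (Suc l)
  have "ln (psi l x) \<le> psi l x - 1"
    using psi_ge_1[OF Suc.prems, of l] by (intro ln_le_minus_one) simp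
  then show ?case using Suc by simp
qed

text \<open>A discrete substitute for the derivative of \<open>psi l\<close>, which is the reciprocal of
  \<open>x * psi 0 x * \<dots> * psi (l - 1) x\<close>; each of these factors is at most \<open>x\<close>.\<close>

lemma psi_increment:
  assumes "1 \<le> x"
  shows "1 / (x + 1) ^ Suc l \<le> psi l (x + 1) - psi l x"
proof (induction l)
  case 0
  have "ln (x / (x + 1)) \<le> x / (x + 1) - 1"
    using assms by (intro ln_le_minus_one) simp
  then show ?case
    using assms by (simp add: ln_div field_simps)
next
  case (Suc l)
  define a b where "a = psi l x" and "b = psi l (x + 1)"
  have a: "1 \<le> a" and b: "1 \<le> b" "b \<le> x + 1"
    using assms psi_ge_1[of x l] psi_ge_1[of "x + 1" l] psi_le[of "x + 1" l] by (auto simp: a_def b_def)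
  have "1 / (x + 1) ^ Suc (Suc l) = (1 / (x + 1) ^ Suc l) / (x + 1)"
    by simp
  also have "\<dots> \<le> (b - a) / b"
    using Suc assms b order_trans[OF _ Suc, of 0] by (intro frac_le) (simp_all add: a_def b_def)
  also have "\<dots> = - (a / b - 1)"
    using b by (simp add: field_simps)
  also have "\<dots> \<le> - ln (a / b)"
    using ln_le_minus_one[of "a / b"] a b by simp
  also have "\<dots> = ln b - ln a"
    using a b by (simp add: ln_div)
  finally show ?case
    by (simp add: a_def b_def)
qed

lemma scalesD:
  assumes "h \<in> scales"
  shows "0 < h" "1 \<le> log 2 (1 / h)" "1 \<le> grid_size h"
    "ln (grid_size h) = (log 2 (1 / h) - 1) * ln 2"
proof -
  from assms obtain k :: nat where k: "1 \<le> k" "h = (1 / 2) ^ k"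
    by (auto simp: scales_def)
  have log: "log 2 (1 / h) = real k"
    by (simp add: k power_one_over log_nat_power)
  have le: "h \<le> 1 / 2"
    using power_decreasing[OF k(1), of "1 / 2 :: real"] by (simp add: k)
  have "ln (grid_size h) = - ln 2 - ln h"
    by (simp add: grid_size_def ln_div ln_mult k)
  also have "ln h = - (real k * ln 2)"
    by (simp add: k ln_realpow ln_div)
  finally have "ln (grid_size h) = (real k - 1) * ln 2"
    by (simp add: algebra_simps)
  then show "ln (grid_size h) = (log 2 (1 / h) - 1) * ln 2"
    by (simp add: log)
  show h: "0 < h" and "1 \<le> log 2 (1 / h)"
    unfolding log using k by auto
  show "1 \<le> grid_size h"
    using h le by (simp add: grid_size_def field_simps)
qed

text \<open>Only two rough facts about the weights matter: they are at most 1, and they decay no faster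
  than a power of \<open>log\<^sub>2 (1 / h)\<close>, which is negligible against \<open>log n\<^sub>h\<close>.\<close>

lemma Pi_weight_bounds:
  assumes "h \<in> scales" "0 < \<epsilon>" "\<epsilon> < 1"
  shows "0 < Pi_weight m \<epsilon> h" "Pi_weight m \<epsilon> h \<le> 1"
    "- ln (Pi_weight m \<epsilon> h) \<le> - ln \<epsilon> + real (m + 3) * ln (log 2 (1 / h) + 1)"
proof -
  define x where "x = log 2 (1 / h)"
  have x: "1 \<le> x"
    using scalesD(2)[OF assms(1)] by (simp add: x_def)
  define a b where "a = psi m x" and "b = psi m (x + 1)"
  have a: "1 \<le> a" and b: "1 \<le> b" "b \<le> x + 1" and ab: "1 / (x + 1) ^ Suc m \<le> b - a"
    using psi_ge_1[of x m] psi_ge_1[of "x + 1" m] psi_le[of "x + 1" m] psi_increment[OF x, of m] x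
    unfolding a_def b_def by linarith+
  have P: "Pi_weight m \<epsilon> h = 1 / a powr \<epsilon> - 1 / b powr \<epsilon>"
    by (simp add: Pi_weight_def a_def b_def x_def)
  have bp: "b powr \<epsilon> \<le> x + 1" "0 < b powr \<epsilon>"
    using powr_mono[of \<epsilon> 1 b] b assms by auto
  have "0 < 1 / (x + 1) ^ Suc m"
    using x by simp
  then have ba: "a < b"
    using ab by linarith
  \<comment> \<open>Of the exponent \<open>m + 3\<close>, the increment of \<open>psi m\<close> takes \<open>m + 1\<close>; one more comes from passing to
    logarithms (division by \<open>b\<close>) and one from the factor \<open>b powr - \<epsilon>\<close>.\<close>
  have "\<epsilon> / (x + 1) ^ (m + 3) = 1 / (x + 1) * (\<epsilon> * ((1 / (x + 1) ^ Suc m) / (x + 1)))"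
    by (simp add: numeral_3_eq_3 field_simps)
  also have "\<dots> \<le> 1 / b powr \<epsilon> * (\<epsilon> * ((b - a) / b))"
    using x b bp ab ba assms by (intro mult_mono frac_le order_refl) auto
  also have "(b - a) / b \<le> ln b - ln a"
    using ln_le_minus_one[of "a / b"] a b by (simp add: ln_div diff_divide_distrib)
  then have "1 / b powr \<epsilon> * (\<epsilon> * ((b - a) / b)) \<le> 1 / b powr \<epsilon> * (\<epsilon> * (ln b - ln a))"
    using assms bp by (intro mult_left_mono) auto
  also have "\<dots> \<le> 1 / b powr \<epsilon> * (exp (\<epsilon> * (ln b - ln a)) - 1)"
  proof (rule mult_left_mono)
    show "\<epsilon> * (ln b - ln a) \<le> exp (\<epsilon> * (ln b - ln a)) - 1"
      using exp_ge_add_one_self[of "\<epsilon> * (ln b - ln a)"] by linarith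
  qed simp
  also have "\<dots> = Pi_weight m \<epsilon> h"
    using a b by (simp add: P powr_def exp_diff right_diff_distrib)
  finally have lower: "\<epsilon> / (x + 1) ^ (m + 3) \<le> Pi_weight m \<epsilon> h" .
  then show pos: "0 < Pi_weight m \<epsilon> h"
    using x assms by (intro less_le_trans[OF _ lower]) simp
  have "1 / a powr \<epsilon> \<le> 1"
    using a assms ge_one_powr_ge_zero[of a \<epsilon>] by simp
  then show "Pi_weight m \<epsilon> h \<le> 1"
    using divide_nonneg_pos[of 1, OF _ bp(2)] unfolding P by linarith
  have "ln (\<epsilon> / (x + 1) ^ (m + 3)) \<le> ln (Pi_weight m \<epsilon> h)"
    using lower pos x assms by (intro ln_mono) auto
  then show "- ln (Pi_weight m \<epsilon> h) \<le> - ln \<epsilon> + real (m + 3) * ln (log 2 (1 / h) + 1)"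
    using x assms by (simp add: ln_div ln_realpow x_def)
qed

lemma score_bound_pos:
  assumes "h \<in> scales" "0 < \<epsilon>" "\<epsilon> < 1"
  shows "0 < score_bound m \<epsilon> \<alpha> h"
  using Pi_weight_bounds(1)[OF assms, of m] scalesD(3)[OF assms(1)] by (simp add: score_bound_def)

lemma Phi_critical_value:
  assumes "h \<in> scales" "0 < \<epsilon>" "\<epsilon> < 1"
  shows "Phi (- critical_value m \<epsilon> \<alpha> h) = 1 / (1 + score_bound m \<epsilon> \<alpha> h)"
  unfolding critical_value_def using score_bound_pos[OF assms]
  by (intro Phi_upper_quantile) (auto simp: field_simps add_pos_pos)

lemma grid_nonempty:
  assumes "h \<in> scales"
  shows "finite (grid h)" "grid h \<noteq> {}"
proof -
  show "finite (grid h)"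
    using finite_card_grid(1)[OF assms] .
  have "card (grid h) \<noteq> 0"
    using finite_card_grid(2)[OF assms] scalesD(3)[OF assms] by auto
  then show "grid h \<noteq> {}"
    by auto
qed

lemma coordinate_accepted_iff:
  assumes "h \<in> scales" "0 < \<epsilon>" "\<epsilon> < 1"
  shows "ln (S v / grid_size h) + ln (Pi_weight m \<epsilon> h) \<le> threshold \<alpha>
    \<longleftrightarrow> - critical_value m \<epsilon> \<alpha> h \<le> v"
proof -
  have n: "0 < grid_size h"
    using scalesD(3)[OF assms(1)] by simp
  have W: "0 < Pi_weight m \<epsilon> h"
    by (rule Pi_weight_bounds(1)[OF assms])
  have "Phi v < 1"
    using Phi_strict_mono[of v "v + 1"] Phi_le_1[of "v + 1"] by simp
  then have S: "0 < S v"
    using Phi_pos[of v] by (simp add: S_def)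
  have "ln (S v / grid_size h) + ln (Pi_weight m \<epsilon> h) = ln (S v / grid_size h * Pi_weight m \<epsilon> h)"
    using S n W by (simp add: ln_mult ln_div)
  also have "\<dots> \<le> threshold \<alpha> \<longleftrightarrow> S v / grid_size h * Pi_weight m \<epsilon> h \<le> exp (threshold \<alpha>)"
    using S n W by (subst exp_le_cancel_iff[symmetric]) (simp add: divide_pos_pos mult_pos_pos)
  also have "\<dots> \<longleftrightarrow> S v \<le> score_bound m \<epsilon> \<alpha> h"
    using n W by (simp add: score_bound_def field_simps)
  also have "\<dots> \<longleftrightarrow> 1 / (1 + score_bound m \<epsilon> \<alpha> h) \<le> Phi v"
    using score_bound_pos[OF assms, of m \<alpha>] Phi_pos[of v] by (simp add: S_def field_simps)
  also have "\<dots> \<longleftrightarrow> - critical_value m \<epsilon> \<alpha> h \<le> v"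
    by (simp add: Phi_le_iff flip: Phi_critical_value[OF assms])
  finally show ?thesis .
qed

lemma test_accepts_iff:
  assumes "0 < \<epsilon>" "\<epsilon> < 1"
  shows "test_statistic \<sigma> m \<epsilon> y \<le> ereal (threshold \<alpha>)
    \<longleftrightarrow> (\<forall>i\<in>indices. - critical_value m \<epsilon> \<alpha> (fst i) \<le> y i / noise_level \<sigma> (fst i))"
proof -
  have "Z_max \<sigma> y h + ln (Pi_weight m \<epsilon> h) \<le> threshold \<alpha>
      \<longleftrightarrow> (\<forall>t\<in>grid h. - critical_value m \<epsilon> \<alpha> h \<le> y (h, t) / noise_level \<sigma> h)"
    if h: "h \<in> scales" for h
  proof -
    have "Z_max \<sigma> y h + ln (Pi_weight m \<epsilon> h) \<le> threshold \<alpha>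
      \<longleftrightarrow> Z_max \<sigma> y h \<le> threshold \<alpha> - ln (Pi_weight m \<epsilon> h)"
      by linarith
    also have "\<dots> \<longleftrightarrow> (\<forall>t\<in>grid h.
        ln (S (y (h, t) / noise_level \<sigma> h) / grid_size h) \<le> threshold \<alpha> - ln (Pi_weight m \<epsilon> h))"
      unfolding Z_max_def using grid_nonempty[OF h] by (subst Max_le_iff) auto
    finally show ?thesis
      using coordinate_accepted_iff[OF h assms, of _ m \<alpha>] by (simp add: le_diff_eq)
  qed
  then show ?thesis
    by (auto simp: test_statistic_def SUP_le_iff indices_def)
qed

section \<open>The type II error of a single alternative\<close>

interpretation noise: prob_space noise_law
  unfolding noise_law_def by (rule prob_space_PiM) (rule std_normal.prob_space_axioms)

lemma countable_indices: "countable indices"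
proof -
  have "scales \<subseteq> range (\<lambda>k. (1 / 2) ^ k)"
    by (auto simp: scales_def)
  then have "countable scales"
    by (rule countable_subset) simp
  then show ?thesis
    unfolding indices_def using grid_nonempty(1) by (intro countable_SIGMA) (auto intro: countable_finite)
qed

lemma measurable_noise_component [measurable]:
  assumes "i \<in> indices"
  shows "(\<lambda>\<xi>. \<xi> i) \<in> borel_measurable noise_law"
  using measurable_component_singleton[OF assms, of "\<lambda>_. std_normal_distribution"]
  unfolding noise_law_def by (simp cong: measurable_cong_sets)

lemma noise_component_prob:
  assumes i: "i \<in> indices" and B: "B \<in> sets borel"
  shows "measure noise_law {\<xi> \<in> space noise_law. \<xi> i \<in> B} = measure std_normal_distribution B"
proof -
  have "distr noise_law std_normal_distribution (\<lambda>\<xi>. \<xi> i) = std_normal_distribution"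
    unfolding noise_law_def by (rule distr_PiM_component[OF std_normal.prob_space_axioms i])
  moreover have "(\<lambda>\<xi>. \<xi> i) \<in> measurable noise_law std_normal_distribution"
    using measurable_noise_component[OF i] by (simp cong: measurable_cong_sets)
  ultimately have "measure std_normal_distribution B = measure noise_law ((\<lambda>\<xi>. \<xi> i) -` B \<inter> space noise_law)"
    using measure_distr[of "\<lambda>\<xi>. \<xi> i" noise_law std_normal_distribution B] B by simp
  then show ?thesis
    by (simp add: vimage_def Int_def conj_commute)
qed

lemma noise_component_ge:
  "i \<in> indices \<Longrightarrow> measure noise_law {\<xi> \<in> space noise_law. c \<le> \<xi> i} = Phi (- c)"
  using noise_component_prob[of i "{c..}"] by (simp add: std_normal_atLeast)

lemma noise_component_less:
  "i \<in> indices \<Longrightarrow> measure noise_law {\<xi> \<in> space noise_law. \<xi> i < c} = Phi c"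
  using noise_component_prob[of i "{..<c}"] by (simp add: std_normal_lessThan Phi_uminus)

lemma noise_level_pos:
  assumes "0 < \<sigma>" "i \<in> indices"
  shows "0 < noise_level \<sigma> (fst i)"
  using assms scalesD(1)[of "fst i"] by (auto simp: noise_level_def indices_def)

lemma acceptance_prob:
  assumes "0 < \<sigma>" "0 < \<epsilon>" "\<epsilon> < 1"
  shows "measure (observation_law \<sigma> \<Theta>)
      {y \<in> space (observation_law \<sigma> \<Theta>). test_statistic \<sigma> m \<epsilon> y \<le> ereal (threshold \<alpha>)}
    = measure noise_law {\<xi> \<in> space noise_law. \<forall>i\<in>indices.
        - critical_value m \<epsilon> \<alpha> (fst i) - \<Theta> i / noise_level \<sigma> (fst i) \<le> \<xi> i}"
proof -
  let ?N = "PiM indices (\<lambda>_. borel :: real measure)"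
  let ?f = "\<lambda>\<xi>. \<lambda>i\<in>indices. \<Theta> i + noise_level \<sigma> (fst i) * \<xi> i"
  let ?Y = "{y \<in> space ?N. \<forall>i\<in>indices. - critical_value m \<epsilon> \<alpha> (fst i) \<le> y i / noise_level \<sigma> (fst i)}"
  have f: "?f \<in> measurable noise_law ?N"
    by (intro measurable_restrict) measurable
  have Y: "?Y \<in> sets ?N"
    by (intro sets.sets_Collect_countable_All' countable_indices) measurable
  have "measure (observation_law \<sigma> \<Theta>)
      {y \<in> space (observation_law \<sigma> \<Theta>). test_statistic \<sigma> m \<epsilon> y \<le> ereal (threshold \<alpha>)}
    = measure noise_law (?f -` ?Y \<inter> space noise_law)"
    by (simp add: observation_law_def test_accepts_iff[OF assms(2,3)] measure_distr[OF f Y])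
  also have "?f -` ?Y \<inter> space noise_law = {\<xi> \<in> space noise_law. \<forall>i\<in>indices.
        - critical_value m \<epsilon> \<alpha> (fst i) - \<Theta> i / noise_level \<sigma> (fst i) \<le> \<xi> i}"
  proof -
    have "- u \<le> (a + n * x) / n \<longleftrightarrow> - u - a / n \<le> x" if "0 < n" for u a n x :: real
      using that by (auto simp: field_simps)
    then show ?thesis
      using measurable_space[OF f] noise_level_pos[OF assms(1)] by auto
  qed
  finally show ?thesis .
qed

text \<open>An upper bound comes from looking at the coordinate \<open>(\<rho>, \<tau>)\<close> alone. It is attained in the
  limit: the remaining means are nonnegative but otherwise free, so they can be raised so fast along
  the countable index set that the total probability of a rejection outside \<open>(\<rho>, \<tau>)\<close> is as small as
  desired. The union bound suffices for this.\<close>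

lemma type_II_error_eq:
  assumes \<sigma>: "0 < \<sigma>" and \<epsilon>: "0 < \<epsilon>" "\<epsilon> < 1" and \<rho>: "\<rho> \<in> scales" "\<tau> \<in> grid \<rho>"
  shows "type_II_error \<sigma> m \<epsilon> \<alpha> \<rho> \<tau> a = Phi (critical_value m \<epsilon> \<alpha> \<rho> - a / noise_level \<sigma> \<rho>)"
proof -
  let ?u = "\<lambda>i. critical_value m \<epsilon> \<alpha> (fst i)"
  let ?n = "\<lambda>i. noise_level \<sigma> (fst i)"
  let ?i = "(\<rho>, \<tau>)"
  let ?p = "Phi (critical_value m \<epsilon> \<alpha> \<rho> - a / noise_level \<sigma> \<rho>)"
  define acc where "acc \<Theta> = {\<xi> \<in> space noise_law. \<forall>i\<in>indices. - ?u i - \<Theta> i / ?n i \<le> \<xi> i}"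
    for \<Theta> :: "real \<times> real \<Rightarrow> real"
  have i: "?i \<in> indices"
    using \<rho> by (simp add: indices_def)
  have error: "type_II_error \<sigma> m \<epsilon> \<alpha> \<rho> \<tau> a = (SUP \<Theta>\<in>alternatives \<rho> \<tau> a. measure noise_law (acc \<Theta>))"
    unfolding type_II_error_def acc_def acceptance_prob[OF \<sigma> \<epsilon>] ..
  have acc_sets: "acc \<Theta> \<in> sets noise_law" for \<Theta>
    unfolding acc_def by (intro sets.sets_Collect_countable_All' countable_indices) measurable
  have single: "measure noise_law {\<xi> \<in> space noise_law. - ?u ?i + a / ?n ?i \<le> \<xi> ?i} = ?p"
    using noise_component_ge[OF i] by simp
  have upper: "measure noise_law (acc \<Theta>) \<le> ?p" if "\<Theta> \<in> alternatives \<rho> \<tau> a" for \<Theta>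
  proof -
    have "measure noise_law (acc \<Theta>) \<le> measure noise_law {\<xi> \<in> space noise_law. - ?u ?i + a / ?n ?i \<le> \<xi> ?i}"
      using that i by (intro noise.finite_measure_mono) (auto simp: acc_def alternatives_def)
    then show ?thesis
      unfolding single .
  qed
  have lower: "\<exists>\<Theta>\<in>alternatives \<rho> \<tau> a. ?p - d \<le> measure noise_law (acc \<Theta>)" if d: "0 < d" for d
  proof -
    let ?e = "\<lambda>k. d * (1 / 2) ^ Suc k"
    have "\<exists>c\<ge>0. Phi (- ?u i - c) \<le> ?e (to_nat_on indices i)" for i
    proof -
      have "\<forall>\<^sub>F x in at_bot. Phi x < ?e (to_nat_on indices i)"
        by (rule order_tendstoD(2)[OF Phi_at_bot]) (use d in simp)
      then obtain N where N: "\<And>x. x \<le> N \<Longrightarrow> Phi x < ?e (to_nat_on indices i)"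
        by (auto simp: eventually_at_bot_linorder)
      show ?thesis
      proof (intro exI conjI)
        show "0 \<le> max 0 (- ?u i - N)"
          by simp
        show "Phi (- ?u i - max 0 (- ?u i - N)) \<le> ?e (to_nat_on indices i)"
          by (rule less_imp_le, rule N) simp
      qed
    qed
    then obtain c where c: "\<And>i. 0 \<le> c i" "\<And>i. Phi (- ?u i - c i) \<le> ?e (to_nat_on indices i)"
      by metis
    define \<Theta> where "\<Theta> i = (if i = ?i then - a else ?n i * c i)" for i
    have alt: "\<Theta> \<in> alternatives \<rho> \<tau> a"
      using c(1) noise_level_pos[OF \<sigma>] by (auto simp: alternatives_def \<Theta>_def less_imp_le)
    \<comment> \<open>The union bound runs over the natural numbers: \<open>bad k\<close> is the rejection event of the index
      numbered \<open>k\<close>, or empty if that is \<open>(\<rho>, \<tau>)\<close> or does not exist.\<close>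
    define bad where "bad k = (\<Union>i\<in>{i \<in> indices. to_nat_on indices i = k \<and> i \<noteq> ?i}.
        {\<xi> \<in> space noise_law. \<xi> i < - ?u i - c i})" for k
    have bad: "bad k \<in> sets noise_law \<and> measure noise_law (bad k) \<le> ?e k" for k
    proof (cases "\<exists>i\<in>indices. to_nat_on indices i = k \<and> i \<noteq> ?i")
      case True
      then obtain j where j: "j \<in> indices" "to_nat_on indices j = k" "j \<noteq> ?i"
        by auto
      have "i = j" if "i \<in> indices" "to_nat_on indices i = k" for i
        using to_nat_on_inj[OF countable_indices that(1) j(1)] that(2) j(2) by simp
      then have "{i \<in> indices. to_nat_on indices i = k \<and> i \<noteq> ?i} = {j}"
        using j by blast
      then have "bad k = {\<xi> \<in> space noise_law. \<xi> j < - ?u j - c j}"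
        by (simp add: bad_def)
      then show ?thesis
        using noise_component_less[OF j(1)] c(2)[of j] j(1,2) by simp
    next
      case False
      then have "bad k = {}"
        by (auto simp: bad_def)
      then show ?thesis
        using d by simp
    qed
    have geo: "?e sums d"
      using sums_mult[OF power_half_series, of d] by simp
    have sm: "summable (\<lambda>k. measure noise_law (bad k))"
    proof (rule summable_comparison_test'[OF sums_summable[OF geo]])
      show "norm (measure noise_law (bad k)) \<le> ?e k" for k
        using bad[of k] by simp
    qed
    have "measure noise_law (\<Union>k. bad k) \<le> (\<Sum>k. measure noise_law (bad k))"
      using bad by (intro noise.finite_measure_subadditive_countably sm) auto
    also have "\<dots> \<le> (\<Sum>k. ?e k)"
      using bad by (intro suminf_le[OF _ sm sums_summable[OF geo]]) blast
    also have "\<dots> = d"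
      using geo by (rule sums_unique[symmetric])
    finally have total: "measure noise_law (\<Union>k. bad k) \<le> d" .
    have "{\<xi> \<in> space noise_law. - ?u ?i + a / ?n ?i \<le> \<xi> ?i} \<subseteq> acc \<Theta> \<union> (\<Union>k. bad k)"
    proof
      fix \<xi> assume \<xi>: "\<xi> \<in> {\<xi> \<in> space noise_law. - ?u ?i + a / ?n ?i \<le> \<xi> ?i}"
      show "\<xi> \<in> acc \<Theta> \<union> (\<Union>k. bad k)"
      proof (rule ccontr)
        assume *: "\<xi> \<notin> acc \<Theta> \<union> (\<Union>k. bad k)"
        then obtain j where j: "j \<in> indices" "\<xi> j < - ?u j - \<Theta> j / ?n j"
          using \<xi> by (auto simp: acc_def not_le)
        then have "j \<noteq> ?i"
          using \<xi> by (auto simp: \<Theta>_def)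
        then have "\<xi> \<in> bad (to_nat_on indices j)"
          using j \<xi> noise_level_pos[OF \<sigma> j(1)]
          unfolding bad_def by (intro UN_I[of j]) (auto simp: \<Theta>_def)
        then show False
          using * by auto
      qed
    qed
    then have "?p \<le> measure noise_law (acc \<Theta> \<union> (\<Union>k. bad k))"
      unfolding single[symmetric] using bad acc_sets
      by (intro noise.finite_measure_mono sets.Un sets.countable_UN) auto
    also have "\<dots> \<le> measure noise_law (acc \<Theta>) + measure noise_law (\<Union>k. bad k)"
      using bad acc_sets by (intro measure_Un_le) auto
    finally show ?thesis
      using total alt by (intro bexI[of _ \<Theta>]) auto
  qed
  show ?thesis
    unfolding error
  proof (rule antisym)
    show "(SUP \<Theta>\<in>alternatives \<rho> \<tau> a. measure noise_law (acc \<Theta>)) \<le> ?p"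
      using lower[of 1] upper by (intro cSUP_least) auto
    show "?p \<le> (SUP \<Theta>\<in>alternatives \<rho> \<tau> a. measure noise_law (acc \<Theta>))"
    proof (rule field_le_epsilon)
      fix d :: real assume "0 < d"
      then obtain \<Theta> where \<Theta>: "\<Theta> \<in> alternatives \<rho> \<tau> a" "?p - d \<le> measure noise_law (acc \<Theta>)"
        using lower by blast
      have "measure noise_law (acc \<Theta>) \<le> (SUP \<Theta>\<in>alternatives \<rho> \<tau> a. measure noise_law (acc \<Theta>))"
        using \<Theta>(1) upper by (intro cSUP_upper bdd_aboveI2[where M="?p"]) auto
      then show "?p \<le> (SUP \<Theta>\<in>alternatives \<rho> \<tau> a. measure noise_law (acc \<Theta>)) + d"
        using \<Theta>(2) by linarith
    qed
  qed
qed

text \<open>By the preceding lemma the error does not depend on the position \<open>t\<close>, so the average over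
  \<open>grid h\<close> disappears.\<close>

lemma mean_type_II_error_eq:
  assumes "0 < \<sigma>" "0 < \<epsilon>" "\<epsilon> < 1"
  shows "mean_type_II_error \<sigma> m \<epsilon> \<alpha> p a =
    (\<Sum>\<^sub>\<infinity>h\<in>scales. p h * Phi (critical_value m \<epsilon> \<alpha> h - a h / noise_level \<sigma> h))"
  unfolding mean_type_II_error_def
proof (rule infsum_cong)
  fix h assume h: "h \<in> scales"
  show "p h / grid_size h * (\<Sum>t\<in>grid h. type_II_error \<sigma> m \<epsilon> \<alpha> h t (a h))
      = p h * Phi (critical_value m \<epsilon> \<alpha> h - a h / noise_level \<sigma> h)"
    using scalesD(3)[OF h] finite_card_grid(2)[OF h] by (simp add: type_II_error_eq[OF assms h])
qed

section \<open>Critical values and detection radii\<close>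

lemma ln_score_bound:
  assumes "h \<in> scales" "0 < \<epsilon>" "\<epsilon> < 1"
  shows "threshold \<alpha> + ln (grid_size h) \<le> ln (score_bound m \<epsilon> \<alpha> h)"
    "ln (1 + score_bound m \<epsilon> \<alpha> h)
      \<le> ln (1 + exp (threshold \<alpha>)) + ln (grid_size h) - ln \<epsilon> + real (m + 3) * ln (log 2 (1 / h) + 1)"
proof -
  define n W where "n = grid_size h" and "W = Pi_weight m \<epsilon> h"
  have n: "1 \<le> n"
    using scalesD(3)[OF assms(1)] by (simp add: n_def)
  have W: "0 < W" "W \<le> 1" "- ln W \<le> - ln \<epsilon> + real (m + 3) * ln (log 2 (1 / h) + 1)"
    using Pi_weight_bounds[OF assms, of m] by (simp_all add: W_def)
  have s: "score_bound m \<epsilon> \<alpha> h = n * exp (threshold \<alpha>) / W"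
    by (simp add: score_bound_def n_def W_def)
  have e: "1 + exp (threshold \<alpha>) \<noteq> 0"
    using exp_gt_zero[of "threshold \<alpha>"] by linarith
  show "threshold \<alpha> + ln (grid_size h) \<le> ln (score_bound m \<epsilon> \<alpha> h)"
    using n W by (simp add: s ln_div ln_mult flip: n_def)
  have "1 * 1 \<le> n * (1 / W)"
    using n W by (intro mult_mono) auto
  then have "1 + score_bound m \<epsilon> \<alpha> h \<le> (1 + exp (threshold \<alpha>)) * n / W"
    by (simp add: s ring_distribs add_divide_distrib mult.commute)
  then have "ln (1 + score_bound m \<epsilon> \<alpha> h) \<le> ln ((1 + exp (threshold \<alpha>)) * n / W)"
    using score_bound_pos[OF assms, of m \<alpha>] by (intro ln_mono) auto
  also have "\<dots> = ln (1 + exp (threshold \<alpha>)) + ln n - ln W"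
    using n W e by (simp add: ln_div ln_mult)
  finally show "ln (1 + score_bound m \<epsilon> \<alpha> h)
      \<le> ln (1 + exp (threshold \<alpha>)) + ln (grid_size h) - ln \<epsilon> + real (m + 3) * ln (log 2 (1 / h) + 1)"
    using W(3) by (simp flip: n_def)
qed

lemma critical_value_upper:
  assumes "h \<in> scales" "0 < \<epsilon>" "\<epsilon> < 1" "0 \<le> critical_value m \<epsilon> \<alpha> h"
  shows "(critical_value m \<epsilon> \<alpha> h)\<^sup>2 \<le> 2 * ln (1 + score_bound m \<epsilon> \<alpha> h)"
proof -
  let ?u = "critical_value m \<epsilon> \<alpha> h" and ?s = "score_bound m \<epsilon> \<alpha> h"
  have s: "0 < ?s"
    by (rule score_bound_pos[OF assms(1-3)])
  have "1 / (1 + ?s) \<le> exp (- ?u\<^sup>2 / 2)"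
    using Phi_upper_tail[OF assms(4)] by (simp only: Phi_critical_value[OF assms(1-3)])
  then have "ln (1 / (1 + ?s)) \<le> ln (exp (- ?u\<^sup>2 / 2))"
    using s by (intro ln_mono) (auto simp: add_pos_pos)
  then show ?thesis
    using s by (simp add: ln_div add_pos_pos)
qed

lemma critical_value_lower:
  assumes "h \<in> scales" "0 < \<epsilon>" "\<epsilon> < 1" "0 < d"
  shows "2 * ln (score_bound m \<epsilon> \<alpha> h) + 2 * ln (d / sqrt (2 * pi)) \<le> (max 0 (critical_value m \<epsilon> \<alpha> h) + d)\<^sup>2"
proof -
  let ?u = "critical_value m \<epsilon> \<alpha> h" and ?s = "score_bound m \<epsilon> \<alpha> h"
  have s: "0 < ?s"
    by (rule score_bound_pos[OF assms(1-3)])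
  let ?v = "max 0 ?u + d"
  have "d / sqrt (2 * pi) * exp (- ?v\<^sup>2 / 2) = d * \<phi> ?v"
    by (simp add: std_normal_density_def)
  also have "\<dots> \<le> 1 / (1 + ?s)"
    using Phi_lower_tail[OF assms(4)] by (simp only: Phi_critical_value[OF assms(1-3), symmetric])
  also have "\<dots> \<le> 1 / ?s"
    using s by (simp add: frac_le)
  finally have "ln (d / sqrt (2 * pi) * exp (- ?v\<^sup>2 / 2)) \<le> ln (1 / ?s)"
    using s assms(4) by (intro ln_mono) auto
  also have "ln (1 / ?s) = - ln ?s"
    using s by (simp add: ln_div)
  also have "ln (d / sqrt (2 * pi) * exp (- ?v\<^sup>2 / 2)) = ln (d / sqrt (2 * pi)) - ?v\<^sup>2 / 2"
    using assms(4) by (subst ln_mult) auto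
  finally show ?thesis
    by simp
qed

text \<open>In the lower bound, the logarithm of the sum of \<open>log n\<^sub>h\<close> and \<open>w = q + ln \<omega>\<close> is at most
  \<open>ln (1 + log n\<^sub>h) + w\<close>, and half of the summand \<open>2 w\<close> pays for \<open>w\<close>. What is left is free of \<open>\<omega>\<close>.\<close>

lemma R_plus_bounds:
  assumes "h \<in> scales" "1 \<le> q + ln \<omega>" "0 \<le> log_star \<omega>"
  shows "2 * ln (grid_size h) - ln (4 * pi) - ln (1 + ln (grid_size h)) \<le> R_plus q \<omega> h"
    "R_plus q \<omega> h \<le> 2 * (q + ln (grid_size h) + ln \<omega>) + log_star \<omega>"
proof -
  define K w where "K = ln (grid_size h)" and "w = q + ln \<omega>"
  have K: "0 \<le> K" and w: "1 \<le> w"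
    using scalesD(3)[OF assms(1)] assms(2) by (simp_all add: K_def w_def)
  have R: "R_plus q \<omega> h = 2 * (K + w) - ln (4 * pi * (K + w)) + log_star \<omega>"
    by (simp add: R_plus_def R_tilde_def K_def w_def algebra_simps)
  have "1 * 1 \<le> 4 * pi * (K + w)"
    using K w pi_gt3 by (intro mult_mono) auto
  then have "0 \<le> ln (4 * pi * (K + w))"
    by simp
  then show "R_plus q \<omega> h \<le> 2 * (q + ln (grid_size h) + ln \<omega>) + log_star \<omega>"
    unfolding R by (simp add: K_def w_def)
  have "K + w \<le> (1 + K) * (1 + w)"
    using K w by (simp add: algebra_simps)
  then have "ln (K + w) \<le> ln ((1 + K) * (1 + w))"
    using K w by (intro ln_mono) auto
  also have "\<dots> = ln (1 + K) + ln (1 + w)"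
    using K w by (intro ln_mult_pos) auto
  also have "\<dots> \<le> ln (1 + K) + w"
    using ln_add_one_self_le_self[of w] w by simp
  finally have "ln (4 * pi * (K + w)) \<le> ln (4 * pi) + ln (1 + K) + w"
    using K w by (simp add: ln_mult)
  then show "2 * ln (grid_size h) - ln (4 * pi) - ln (1 + ln (grid_size h)) \<le> R_plus q \<omega> h"
    using w assms(3) unfolding R K_def[symmetric] by (smt (verit))
qed

lemma eventually_beyond_sqrt:
  fixes P :: "real \<Rightarrow> bool"
  assumes "eventually P at_top"
  shows "\<forall>\<^sub>F \<omega> in at_top. \<forall>k\<ge>sqrt \<omega>. P k"
proof -
  obtain K where K: "\<And>k. K \<le> k \<Longrightarrow> P k"
    using assms by (auto simp: eventually_at_top_linorder)
  have "\<forall>\<^sub>F \<omega> in at_top. K \<le> sqrt \<omega>"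
    by real_asymp
  then show ?thesis
    by eventually_elim (auto intro: K order_trans)
qed

text \<open>Where \<open>log\<^sub>2 (1 / h) \<ge> sqrt \<omega>\<close>, \<open>R_plus\<close> is at least \<open>log n\<^sub>h\<close>, hence of order \<open>sqrt \<omega>\<close> or more,
  while the square of the critical value differs from \<open>R_plus\<close> by terms that are logarithmic in \<open>\<omega>\<close>
  or in \<open>log n\<^sub>h\<close>. Those terms are negligible against \<open>sqrt R_plus\<close>. The cutoff \<open>sqrt \<omega>\<close> is a
  convenient choice between \<open>(ln \<omega>)\<^sup>2\<close>, which it has to exceed for the terms in \<open>\<omega>\<close> to be negligible,
  and \<open>\<omega>\<close>, below which the prior puts little mass.\<close>

lemma critical_value_asymptotics:
  assumes \<epsilon>: "0 < \<epsilon>" "\<epsilon> < 1" and d: "0 < d"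
  shows "\<forall>\<^sub>F \<omega> in at_top. \<forall>h\<in>scales. sqrt \<omega> \<le> log 2 (1 / h) \<longrightarrow>
    (sqrt \<omega> - 1) * ln 2 \<le> R_plus (threshold \<alpha>) \<omega> h \<and>
    sqrt (R_plus (threshold \<alpha>) \<omega> h) - 2 * d \<le> critical_value m \<epsilon> \<alpha> h \<and>
    critical_value m \<epsilon> \<alpha> h \<le> sqrt (R_plus (threshold \<alpha>) \<omega> h) + 1"
proof -
  define q where "q = threshold \<alpha>"
  define c0 where "c0 = ln (d / sqrt (2 * pi))"
  define c where "c = 1 + d\<^sup>2 + 2 * \<bar>c0\<bar>"
  define b where "b = ln (4 * pi)"
  define C where "C = 1 + \<bar>2 * ln (1 + exp q) - 2 * ln \<epsilon> + b\<bar>"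
  define D where "D = real (m + 3)"
  have b: "0 < b"
    using pi_gt3 by (simp add: b_def)
  have c: "0 < c" and C: "0 < C" and D: "0 < D"
    by (simp_all add: c_def C_def D_def add_pos_nonneg)
  have "\<forall>\<^sub>F k in at_top. b + ln (1 + (k - 1) * ln 2) \<le> (k - 1) * ln (2::real)"
    using b by real_asymp
  then have E1: "\<forall>\<^sub>F \<omega> in at_top. \<forall>k\<ge>sqrt \<omega>. b + ln (1 + (k - 1) * ln 2) \<le> (k - 1) * ln (2::real)"
    by (rule eventually_beyond_sqrt)
  have "\<forall>\<^sub>F k in at_top. C + 2 * D * ln (k + 1) + ln (1 + (k - 1) * ln 2) \<le> 2 * sqrt ((k - 1) * ln (2::real))"
    using C D by real_asymp
  then have E2: "\<forall>\<^sub>F \<omega> in at_top. \<forall>k\<ge>sqrt \<omega>.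
      C + 2 * D * ln (k + 1) + ln (1 + (k - 1) * ln 2) \<le> 2 * sqrt ((k - 1) * ln (2::real))"
    by (rule eventually_beyond_sqrt)
  have E3: "\<forall>\<^sub>F \<omega> in at_top. 2 * ln \<omega> + log_star \<omega> + c \<le> 2 * d * sqrt ((sqrt \<omega> - 1) * ln 2)"
    unfolding log_star_def using c d by real_asymp
  have E4: "\<forall>\<^sub>F \<omega> in at_top. 2 * d < sqrt ((sqrt \<omega> - 1) * ln 2)"
    by real_asymp
  have E5: "\<forall>\<^sub>F \<omega> in at_top. 1 \<le> q + ln \<omega>"
    by real_asymp
  have E6: "\<forall>\<^sub>F \<omega> in at_top. 0 \<le> log_star \<omega>"
    unfolding log_star_def by real_asymp
  have E7: "\<forall>\<^sub>F \<omega>::real in at_top. 1 \<le> \<omega>"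
    by real_asymp
  show ?thesis
    using E1 E2 E3 E4 E5 E6 E7
  proof (eventually_elim, intro ballI impI)
    fix \<omega> h
    assume E1: "\<forall>k\<ge>sqrt \<omega>. b + ln (1 + (k - 1) * ln 2) \<le> (k - 1) * ln (2::real)"
      and E2: "\<forall>k\<ge>sqrt \<omega>. C + 2 * D * ln (k + 1) + ln (1 + (k - 1) * ln 2) \<le> 2 * sqrt ((k - 1) * ln (2::real))"
      and E3: "2 * ln \<omega> + log_star \<omega> + c \<le> 2 * d * sqrt ((sqrt \<omega> - 1) * ln 2)"
      and E4: "2 * d < sqrt ((sqrt \<omega> - 1) * ln 2)"
      and E5: "1 \<le> q + ln \<omega>" and E6: "0 \<le> log_star \<omega>" and E7: "1 \<le> \<omega>"
      and h: "h \<in> scales" and k: "sqrt \<omega> \<le> log 2 (1 / h)"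
    define K where "K = ln (grid_size h)"
    define r where "r = R_plus q \<omega> h"
    define u where "u = critical_value m \<epsilon> \<alpha> h"
    have K_eq: "K = (log 2 (1 / h) - 1) * ln 2"
      unfolding K_def by (rule scalesD(4)[OF h])
    have K_ge: "(sqrt \<omega> - 1) * ln 2 \<le> K"
      unfolding K_eq using k by (intro mult_right_mono) auto
    have "0 \<le> (sqrt \<omega> - 1) * ln 2"
      using E7 by simp
    then have K0: "0 \<le> K"
      using K_ge by linarith
    have R_low: "2 * K - b - ln (1 + K) \<le> r"
      and R_up: "r \<le> 2 * (q + K + ln \<omega>) + log_star \<omega>"
      using R_plus_bounds[OF h E5 E6] by (simp_all add: K_def r_def b_def)
    have "b + ln (1 + K) \<le> K"
      unfolding K_eq using E1 k by blast
    then have KR: "K \<le> r"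
      using R_low by linarith
    then have r0: "0 \<le> r"
      using K0 by linarith
    have sqrt_r: "sqrt ((sqrt \<omega> - 1) * ln 2) \<le> sqrt r"
      using K_ge KR by simp
    have upper: "u \<le> sqrt r + 1"
    proof (cases "0 \<le> u")
      case True
      have "u\<^sup>2 \<le> 2 * ln (1 + score_bound m \<epsilon> \<alpha> h)"
        using critical_value_upper[OF h \<epsilon>] True unfolding u_def by simp
      also have "\<dots> \<le> 2 * (ln (1 + exp q) + K - ln \<epsilon> + D * ln (log 2 (1 / h) + 1))"
        using ln_score_bound(2)[OF h \<epsilon>, where m=m and \<alpha>=\<alpha>] unfolding q_def K_def D_def by simp
      also have "\<dots> \<le> 2 * K - b + (C + 2 * D * ln (log 2 (1 / h) + 1))"
        unfolding C_def by (simp add: distrib_left)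
      also have "\<dots> \<le> 2 * K - b + (2 * sqrt K - ln (1 + K))"
        using E2[rule_format, OF k] unfolding K_eq by simp
      also have "\<dots> \<le> r + 2 * sqrt r"
        using R_low real_sqrt_le_mono[OF KR] by linarith
      also have "\<dots> \<le> (sqrt r + 1)\<^sup>2"
        using r0 by (simp add: power2_eq_square algebra_simps)
      finally show ?thesis
        by (rule power2_le_imp_le) (simp add: r0)
    next
      case False
      then show ?thesis
        using real_sqrt_ge_zero[OF r0] by linarith
    qed
    have lower: "sqrt r - 2 * d \<le> u"
    proof (rule ccontr)
      assume "\<not> sqrt r - 2 * d \<le> u"
      then have less: "max 0 u + d < sqrt r - d"
        using sqrt_r E4 by linarith
      \<comment> \<open>With the weight estimated by 1, the left-hand side lacks the term \<open>2 * ln \<omega>\<close> of \<open>r\<close>; the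
        slack \<open>2 * d * sqrt r\<close> absorbs it.\<close>
      have "2 * (q + K) + (d\<^sup>2 - c) \<le> 2 * ln (score_bound m \<epsilon> \<alpha> h) + 2 * c0"
        using ln_score_bound(1)[OF h \<epsilon>, where m=m and \<alpha>=\<alpha>] abs_ge_minus_self[of c0]
        by (simp add: q_def K_def c_def)
      also have "\<dots> \<le> (max 0 u + d)\<^sup>2"
        using critical_value_lower[OF h \<epsilon> d] unfolding u_def c0_def by simp
      also have "\<dots> < (sqrt r - d)\<^sup>2"
        using less d by (intro power_strict_mono) auto
      also have "\<dots> = r - 2 * d * sqrt r + d\<^sup>2"
        using r0 by (simp add: power2_diff)
      also have "\<dots> \<le> 2 * (q + K + ln \<omega>) + log_star \<omega> - 2 * d * sqrt ((sqrt \<omega> - 1) * ln 2) + d\<^sup>2"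
        using R_up sqrt_r d by (intro add_mono diff_mono mult_left_mono) auto
      finally show False
        using E3 by simp
    qed
    show "(sqrt \<omega> - 1) * ln 2 \<le> R_plus (threshold \<alpha>) \<omega> h \<and>
        sqrt (R_plus (threshold \<alpha>) \<omega> h) - 2 * d \<le> critical_value m \<epsilon> \<alpha> h \<and>
        critical_value m \<epsilon> \<alpha> h \<le> sqrt (R_plus (threshold \<alpha>) \<omega> h) + 1"
      using upper lower K_ge KR by (simp add: r_def u_def q_def)
  qed
qed

section \<open>The prior gives little mass to coarse scales\<close>

text \<open>Were the normalizer 0, all values of the prior would be 0, and they could not sum to 1; and the
  series converges because the prior is a multiple of it that does.\<close>

lemma prior_normalizer:
  assumes \<nu>: "\<forall>x>0. 0 \<le> \<nu> x" and "0 < \<omega>" and p: "prob_dist_finite_entropy (prior \<nu> \<omega>)"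
  shows "0 < (\<Sum>k. \<nu> (real (Suc k) / \<omega>))" "summable (\<lambda>k. \<nu> (real (Suc k) / \<omega>))"
proof -
  define D where "D = (\<Sum>k. \<nu> (real (Suc k) / \<omega>))"
  have log: "log 2 (1 / (1 / 2) ^ k) = real k" for k
    by (simp add: power_one_over log_nat_power)
  have "bij_betw (\<lambda>k. (1 / 2) ^ Suc k :: real) UNIV scales"
  proof (rule bij_betwI')
    fix x y :: nat
    show "(1 / 2 :: real) ^ Suc x = (1 / 2) ^ Suc y \<longleftrightarrow> x = y"
      using power_inject_exp'[of "1 / 2 :: real" "Suc x" "Suc y"] by simp
  next
    fix x :: nat
    show "(1 / 2 :: real) ^ Suc x \<in> scales"
      unfolding scales_def by (intro CollectI exI[of _ "Suc x"]) simp
  next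
    fix h assume "h \<in> scales"
    then obtain k where "1 \<le> k" "h = (1 / 2) ^ k"
      by (auto simp: scales_def)
    then show "\<exists>x\<in>UNIV. h = (1 / 2) ^ Suc x"
      by (cases k) auto
  qed
  then have "((\<lambda>k. prior \<nu> \<omega> ((1 / 2) ^ Suc k)) has_sum 1) UNIV"
    using p by (subst has_sum_reindex_bij_betw) (auto simp: prob_dist_finite_entropy_def)
  then have sums: "(\<lambda>k. \<nu> (real (Suc k) / \<omega>) / D) sums 1"
    unfolding prior_def log D_def by (rule has_sum_imp_sums)
  have "D \<noteq> 0"
  proof
    assume "D = 0"
    then have "(\<lambda>_::nat. 0::real) sums 1"
      using sums by simp
    then show False
      using sums_unique2[OF _ sums_zero] by fastforce
  qed
  then show "summable (\<lambda>k. \<nu> (real (Suc k) / \<omega>))"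
    using summable_mult2[OF sums_summable[OF sums], of D] by simp
  then have "0 \<le> D"
    unfolding D_def using \<nu> assms(2) by (intro suminf_nonneg) auto
  with \<open>D \<noteq> 0\<close> show "0 < (\<Sum>k. \<nu> (real (Suc k) / \<omega>))"
    by (simp add: D_def)
qed

lemma density_bounded_below_on_interval:
  assumes "admissible_density \<nu>"
  obtains a r c where "0 < a" "0 < r" "0 < c" "\<And>x. a \<le> x \<Longrightarrow> x \<le> a + r \<Longrightarrow> c \<le> \<nu> x"
proof -
  have nonneg: "\<forall>x>0. 0 \<le> \<nu> x" and int: "(LINT x:{0<..}|lborel. \<nu> x) = 1"
    and cont: "continuous_on {0<..} \<nu>"
    using assms by (auto simp: admissible_density_def)
  have "\<exists>a>0. \<nu> a \<noteq> 0"
  proof (rule ccontr)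
    assume "\<not> (\<exists>a>0. \<nu> a \<noteq> 0)"
    then have "(LINT x:{0<..}|lborel. \<nu> x) = (LINT x:{0<..}|lborel. 0 * \<nu> x)"
      by (intro set_lebesgue_integral_cong) auto
    then show False
      using int by simp
  qed
  then obtain a where a: "0 < a" "0 < \<nu> a"
    using nonneg by (metis less_eq_real_def)
  have "isCont \<nu> a"
    using cont a(1) by (simp add: continuous_on_eq_continuous_at)
  then have "\<forall>\<^sub>F x in nhds a. \<nu> a / 2 < \<nu> x"
    using a(2) by (intro order_tendstoD(1)[of \<nu> "\<nu> a"]) (auto simp: isCont_def tendsto_at_iff_tendsto_nhds)
  then obtain e where e: "0 < e" "\<And>x. dist x a < e \<Longrightarrow> \<nu> a / 2 < \<nu> x"
    by (auto simp: eventually_nhds_metric)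
  show ?thesis
    by (rule that[of a "e / 2" "\<nu> a / 2"]) (use a e in \<open>auto simp: dist_real_def intro!: less_imp_le\<close>)
qed

text \<open>The numerators \<open>\<nu> (k / \<omega>)\<close> are bounded, while the normalizer is at least of order \<open>\<omega>\<close>: that
  many points \<open>k / \<omega>\<close> fall into an interval on which \<open>\<nu>\<close> is bounded away from 0. Hence any \<open>o(\<omega>)\<close>
  scales together have vanishing mass. Nothing similar holds for very fine scales, because \<open>\<nu>\<close> may
  have thin spikes that the points \<open>k / \<omega>\<close> happen to hit.\<close>

lemma prior_coarse_scales:
  assumes \<nu>: "admissible_density \<nu>"
    and p: "\<forall>\<^sub>F \<omega> in at_top. prob_dist_finite_entropy (prior \<nu> \<omega>)" and e: "0 < e"
  shows "\<forall>\<^sub>F \<omega> in at_top. infsum (prior \<nu> \<omega>) {h\<in>scales. log 2 (1 / h) < sqrt \<omega>} \<le> e"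
proof -
  obtain a r c where a: "0 < a" and r: "0 < r" and c: "0 < c"
    and low: "\<And>x. a \<le> x \<Longrightarrow> x \<le> a + r \<Longrightarrow> c \<le> \<nu> x"
    using density_bounded_below_on_interval[OF \<nu>] by metis
  have nonneg: "\<forall>x>0. 0 \<le> \<nu> x"
    using \<nu> by (simp add: admissible_density_def)
  obtain b where b: "\<And>x. 0 < x \<Longrightarrow> \<nu> x \<le> b"
    using \<nu> by (auto simp: admissible_density_def)
  have b0: "0 < b"
    using c low[of a] b[OF a] r by simp
  have E: "\<forall>\<^sub>F \<omega> in at_top. sqrt \<omega> * b \<le> e * (c * (r * \<omega> - 2))"
    using e c r b0 by real_asymp
  have "\<forall>\<^sub>F \<omega> in at_top. 2 \<le> r * \<omega>"
    using r by real_asymp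
  then have "\<forall>\<^sub>F \<omega>::real in at_top. 0 < \<omega> \<and> 2 \<le> r * \<omega>"
    using eventually_gt_at_top[of 0] by eventually_elim simp
  then show ?thesis
    using E p
  proof eventually_elim
    fix \<omega> assume w: "0 < \<omega> \<and> 2 \<le> r * \<omega>" and E: "sqrt \<omega> * b \<le> e * (c * (r * \<omega> - 2))"
      and p: "prob_dist_finite_entropy (prior \<nu> \<omega>)"
    define D where "D = (\<Sum>k. \<nu> (real (Suc k) / \<omega>))"
    have D: "0 < D" and sm: "summable (\<lambda>k. \<nu> (real (Suc k) / \<omega>))"
      using prior_normalizer[OF nonneg _ p] w by (auto simp: D_def)
    have D_low: "c * (r * \<omega> - 2) \<le> D"
    proof -
      define F where "F = {nat \<lceil>a * \<omega>\<rceil>..<nat \<lfloor>(a + r) * \<omega>\<rfloor>}"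
      have aw: "0 \<le> a * \<omega>" "0 \<le> (a + r) * \<omega>"
        using a r w by auto
      have "r * \<omega> - 2 \<le> real (card F)"
        using aw unfolding F_def by (simp add: algebra_simps) linarith
      then have "c * (r * \<omega> - 2) \<le> c * real (card F)"
        using c by simp
      also have "\<dots> = (\<Sum>k\<in>F. c)"
        by simp
      also have "\<dots> \<le> (\<Sum>k\<in>F. \<nu> (real (Suc k) / \<omega>))"
      proof (rule sum_mono, rule low)
        fix k assume "k \<in> F"
        then have k: "nat \<lceil>a * \<omega>\<rceil> \<le> k" "Suc k \<le> nat \<lfloor>(a + r) * \<omega>\<rfloor>"
          by (auto simp: F_def)
        then have "a * \<omega> \<le> real (Suc k)"
          by linarith
        then show "a \<le> real (Suc k) / \<omega>"
          using w by (simp add: pos_le_divide_eq)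
        have "real (Suc k) \<le> (a + r) * \<omega>"
          using k(2) aw(2) by linarith
        then show "real (Suc k) / \<omega> \<le> a + r"
          using w by (simp add: pos_divide_le_eq)
      qed
      also have "\<dots> \<le> D"
        unfolding D_def using nonneg w by (intro sum_le_suminf sm) (auto simp: F_def)
      finally show ?thesis .
    qed
    let ?B = "{h\<in>scales. log 2 (1 / h) < sqrt \<omega>}"
    have sub: "?B \<subseteq> (\<lambda>k. (1 / 2) ^ k) ` {1..nat \<lfloor>sqrt \<omega>\<rfloor>}"
    proof
      fix h assume "h \<in> ?B"
      then obtain k where k: "1 \<le> k" "h = (1 / 2) ^ k" "log 2 (1 / h) < sqrt \<omega>"
        by (auto simp: scales_def)
      then have "real k < sqrt \<omega>"
        by (simp add: power_one_over log_nat_power)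
      then have "k \<in> {1..nat \<lfloor>sqrt \<omega>\<rfloor>}"
        using k(1) by (simp add: le_nat_floor)
      with k(2) show "h \<in> (\<lambda>k. (1 / 2) ^ k) ` {1..nat \<lfloor>sqrt \<omega>\<rfloor>}"
        by blast
    qed
    then have fin: "finite ?B"
      by (rule finite_subset) simp
    have "card ?B \<le> card {1..nat \<lfloor>sqrt \<omega>\<rfloor>}"
      using sub by (rule surj_card_le[rotated]) simp
    then have card: "real (card ?B) \<le> sqrt \<omega>"
      using real_sqrt_ge_zero[of \<omega>] w of_nat_floor[of "sqrt \<omega>"] by (simp add: order_trans[OF of_nat_mono])
    have "infsum (prior \<nu> \<omega>) ?B = (\<Sum>h\<in>?B. prior \<nu> \<omega> h)"
      using fin by simp
    also have "\<dots> \<le> (\<Sum>h\<in>?B. b / D)"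
    proof (rule sum_mono)
      fix h assume "h \<in> ?B"
      then have "0 < log 2 (1 / h)"
        using scalesD(2)[of h] by simp
      then have "\<nu> (log 2 (1 / h) / \<omega>) \<le> b"
        using w by (intro b divide_pos_pos) auto
      then show "prior \<nu> \<omega> h \<le> b / D"
        using D by (simp add: prior_def D_def divide_right_mono)
    qed
    also have "\<dots> = real (card ?B) * b / D"
      by simp
    also have "\<dots> \<le> sqrt \<omega> * b / D"
      using card b0 D by (intro divide_right_mono mult_right_mono) auto
    also have "\<dots> \<le> e"
      using E D_low D e order_trans[OF E mult_left_mono[OF D_low, of e]] by (simp add: pos_divide_le_eq)
    finally show "infsum (prior \<nu> \<omega>) ?B \<le> e" .
  qed
qed

section \<open>Averages over the prior\<close>

lemma expectation_pos_part_Markov: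
  assumes p: "\<And>h. h \<in> scales \<Longrightarrow> 0 \<le> p h" "p summable_on scales" and c: "0 < c" and e: "0 \<le> e"
    and E: "expectation_pos_part p f \<le> ennreal (e * c)"
  shows "infsum p {h\<in>scales. c < f h} \<le> e"
proof (rule infsum_le_finite_sums)
  show "p summable_on {h\<in>scales. c < f h}"
    by (rule summable_on_subset_banach[OF p(2)]) auto
  fix F assume F: "finite F" "F \<subseteq> {h\<in>scales. c < f h}"
  have "ennreal (sum p F * c) = (\<Sum>h\<in>F. ennreal (p h * c))"
    using F p(1) c by (subst sum_ennreal) (auto simp: sum_distrib_right)
  also have "\<dots> \<le> (\<Sum>h\<in>F. ennreal (p h) * ennreal (max (f h) 0))"
    using F p(1) c by (intro sum_mono) (auto simp: ennreal_mult subset_eq intro!: mult_left_mono ennreal_leI)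
  also have "\<dots> = (\<integral>\<^sup>+h. ennreal (p h) * ennreal (max (f h) 0) \<partial>count_space F)"
    using F(1) by (rule nn_integral_count_space_finite[symmetric])
  also have "\<dots> = (\<integral>\<^sup>+h. ennreal (p h) * ennreal (max (f h) 0) * indicator F h \<partial>count_space UNIV)"
    by (simp add: nn_integral_count_space_indicator)
  also have "\<dots> \<le> (\<integral>\<^sup>+h. ennreal (p h) * ennreal (max (f h) 0) * indicator scales h \<partial>count_space UNIV)"
    using F(2) by (intro nn_integral_mono) (auto simp: indicator_def)
  also have "\<dots> = expectation_pos_part p f"
    by (simp add: expectation_pos_part_def nn_integral_count_space_indicator)
  also have "\<dots> \<le> ennreal (e * c)"
    by (rule E)
  finally have "sum p F * c \<le> e * c"
    using c e by (simp add: ennreal_le_iff)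
  then show "sum p F \<le> e"
    using c by simp
qed

text \<open>Both parts of the theorem use Markov's inequality at the level \<open>\<eta> log_star \<omega>\<close>, which is exactly
  the slack that \<open>\<eta>\<close> provides in their hypotheses.\<close>

lemma exceedance_mass_vanishes:
  assumes lim: "((\<lambda>\<omega>. ennreal (1 / log_star \<omega>) * expectation_pos_part (P \<omega>) (f \<omega>)) \<longlongrightarrow> 0) at_top"
    and p: "\<forall>\<^sub>F \<omega> in at_top. prob_dist_finite_entropy (P \<omega>)" and \<eta>: "0 < \<eta>" and e: "0 < e"
  shows "\<forall>\<^sub>F \<omega> in at_top. infsum (P \<omega>) {h\<in>scales. \<eta> * log_star \<omega> < f \<omega> h} \<le> e"
proof -
  have "\<forall>\<^sub>F \<omega> in at_top. ennreal (1 / log_star \<omega>) * expectation_pos_part (P \<omega>) (f \<omega>) < ennreal (e * \<eta>)"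
    using order_tendstoD(2)[OF lim, of "ennreal (e * \<eta>)"] e \<eta> by simp
  moreover have "\<forall>\<^sub>F \<omega> in at_top. 0 < log_star \<omega>"
    unfolding log_star_def by real_asymp
  ultimately show ?thesis
    using p
  proof eventually_elim
    fix \<omega> assume less: "ennreal (1 / log_star \<omega>) * expectation_pos_part (P \<omega>) (f \<omega>) < ennreal (e * \<eta>)"
      and L: "0 < log_star \<omega>" and p: "prob_dist_finite_entropy (P \<omega>)"
    let ?L = "log_star \<omega>" and ?E = "expectation_pos_part (P \<omega>) (f \<omega>)"
    have "?E = ennreal (?L * (1 / ?L)) * ?E"
      using L by simp
    also have "\<dots> = ennreal ?L * (ennreal (1 / ?L) * ?E)"
      using L by (subst ennreal_mult) (auto simp: mult.assoc)
    also have "\<dots> \<le> ennreal ?L * ennreal (e * \<eta>)"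
      using less by (intro mult_left_mono) auto
    also have "\<dots> = ennreal (e * (\<eta> * ?L))"
      using L e \<eta> by (simp add: ennreal_mult[symmetric] mult_ac)
    finally show "infsum (P \<omega>) {h\<in>scales. \<eta> * ?L < f \<omega> h} \<le> e"
      using p L e \<eta> by (intro expectation_pos_part_Markov)
        (auto simp: prob_dist_finite_entropy_def dest: has_sum_imp_summable)
  qed
qed

lemma has_sum_indicator:
  fixes p :: "real \<Rightarrow> real"
  assumes "p summable_on A" "B \<subseteq> A"
  shows "((\<lambda>h. p h * indicator B h) has_sum infsum p B) A"
proof -
  have "(p has_sum infsum p B) B"
    using summable_on_subset_banach[OF assms] by simp
  then show ?thesis
    using assms(2) by (subst has_sum_cong_neutral[where T=B and g=p]) auto
qed

text \<open>Errors are probabilities, so scales from the two exceptional sets \<open>B\<close> and \<open>B'\<close> change the average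
  by no more than their mass.\<close>

lemma prior_average_bounds:
  fixes p g :: "real \<Rightarrow> real"
  assumes p: "prob_dist_finite_entropy p"
    and g: "\<And>h. 0 \<le> g h" "\<And>h. g h \<le> 1" and c: "0 \<le> c" "c \<le> 1"
    and B: "B \<subseteq> scales" "B' \<subseteq> scales" "infsum p B \<le> e" "infsum p B' \<le> e"
  shows "(\<And>h. h \<in> scales - B - B' \<Longrightarrow> c \<le> g h) \<Longrightarrow> c - 2 * e \<le> (\<Sum>\<^sub>\<infinity>h\<in>scales. p h * g h)"
    "(\<And>h. h \<in> scales - B - B' \<Longrightarrow> g h \<le> c) \<Longrightarrow> (\<Sum>\<^sub>\<infinity>h\<in>scales. p h * g h) \<le> c + 2 * e"
proof -
  have nonneg: "\<And>h. h \<in> scales \<Longrightarrow> 0 \<le> p h" and total: "(p has_sum 1) scales"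
    using p by (auto simp: prob_dist_finite_entropy_def)
  have sm: "p summable_on scales"
    using total by (rule has_sum_imp_summable)
  have "(\<lambda>h. p h * g h) summable_on scales"
    using nonneg g by (intro summable_on_comparison_test[OF sm]) (auto intro: mult_left_le)
  then have avg: "((\<lambda>h. p h * g h) has_sum (\<Sum>\<^sub>\<infinity>h\<in>scales. p h * g h)) scales"
    by simp
  have exc: "((\<lambda>h. p h * indicator B h + p h * indicator B' h) has_sum (infsum p B + infsum p B')) scales"
    by (intro has_sum_add has_sum_indicator sm B)
  have const: "((\<lambda>h. p h * c) has_sum c) scales"
    using has_sum_cmult_left[OF total, of c] by simp
  show "c - 2 * e \<le> (\<Sum>\<^sub>\<infinity>h\<in>scales. p h * g h)" if good: "\<And>h. h \<in> scales - B - B' \<Longrightarrow> c \<le> g h"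
  proof -
    have "c \<le> (\<Sum>\<^sub>\<infinity>h\<in>scales. p h * g h) + (infsum p B + infsum p B')"
    proof (rule has_sum_mono[OF const has_sum_add[OF avg exc]])
      fix h assume h: "h \<in> scales"
      have "c \<le> g h + indicator B h + indicator B' h"
        using good[of h] h c g(1)[of h] by (auto simp: indicator_def)
      from mult_left_mono[OF this nonneg[OF h]] show "p h * c \<le> p h * g h + (p h * indicator B h + p h * indicator B' h)"
        by (simp add: distrib_left add.assoc)
    qed
    then show ?thesis
      using B by linarith
  qed
  show "(\<Sum>\<^sub>\<infinity>h\<in>scales. p h * g h) \<le> c + 2 * e" if good: "\<And>h. h \<in> scales - B - B' \<Longrightarrow> g h \<le> c"
  proof -
    have "(\<Sum>\<^sub>\<infinity>h\<in>scales. p h * g h) \<le> c + (infsum p B + infsum p B')"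
    proof (rule has_sum_mono[OF avg has_sum_add[OF const exc]])
      fix h assume h: "h \<in> scales"
      have "g h \<le> c + indicator B h + indicator B' h"
        using good[of h] h c g(2)[of h] by (auto simp: indicator_def)
      from mult_left_mono[OF this nonneg[OF h]] show "p h * g h \<le> p h * c + (p h * indicator B h + p h * indicator B' h)"
        by (simp add: distrib_left add.assoc)
    qed
    then show ?thesis
      using B by linarith
  qed
qed

section \<open>The theorem\<close>

text \<open>Where the bracket in the hypothesis is at most \<open>\<eta> log_star \<omega>\<close>, \<open>A \<omega> h / noise_level \<sigma> h\<close> is at
  most \<open>x + sqrt R_plus\<close>, which exceeds the critical value by at most \<open>x + 2 d\<close>.\<close>

lemma mean_type_II_error_lower:
  fixes A :: "real \<Rightarrow> real \<Rightarrow> real"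
  assumes \<sigma>: "0 < \<sigma>" and \<epsilon>: "0 < \<epsilon>" "\<epsilon> < 1" and \<nu>: "admissible_density \<nu>"
    and p: "\<forall>\<^sub>F \<omega> in at_top. prob_dist_finite_entropy (prior \<nu> \<omega>)" and \<eta>: "0 < \<eta>"
    and lim: "((\<lambda>\<omega>. ennreal (1 / log_star \<omega>) *
      expectation_pos_part (prior \<nu> \<omega>)
        (\<lambda>h. (A \<omega> h / noise_level \<sigma> h - x)\<^sup>2 + \<eta> * log_star \<omega> - R_plus (threshold \<alpha>) \<omega> h)) \<longlongrightarrow> 0) at_top"
    and y: "y < Phi (- x)"
  shows "\<forall>\<^sub>F \<omega> in at_top. y \<le> mean_type_II_error \<sigma> m \<epsilon> \<alpha> (prior \<nu> \<omega>) (A \<omega>)"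
proof -
  have "((\<lambda>d. Phi (- x - 2 * d)) \<longlongrightarrow> Phi (- x - 2 * 0)) (at_right 0)"
    by (intro isCont_tendsto_compose[OF isCont_Phi] tendsto_intros)
  then have "\<forall>\<^sub>F d in at_right 0. y < Phi (- x - 2 * d)"
    using y by (intro order_tendstoD(1)) auto
  then have "\<forall>\<^sub>F d in at_right 0. y < Phi (- x - 2 * d) \<and> 0 < d"
    using eventually_at_right_less[of 0] by eventually_elim simp
  then obtain d where d: "0 < d" "y < Phi (- x - 2 * d)"
    using eventually_happens[of _ "at_right (0::real)"] by auto
  \<comment> \<open>Two exceptional sets of mass \<open>e\<close> may use up the gap between \<open>y\<close> and \<open>Phi (- x - 2 * d)\<close>.\<close>
  define e where "e = (Phi (- x - 2 * d) - y) / 2"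
  have e: "0 < e"
    using d by (simp add: e_def)
  show ?thesis
    using critical_value_asymptotics[OF \<epsilon> d(1), of \<alpha> m] prior_coarse_scales[OF \<nu> p e]
      exceedance_mass_vanishes[OF lim p \<eta> e] p
  proof eventually_elim
    fix \<omega>
    assume crit: "\<forall>h\<in>scales. sqrt \<omega> \<le> log 2 (1 / h) \<longrightarrow>
        (sqrt \<omega> - 1) * ln 2 \<le> R_plus (threshold \<alpha>) \<omega> h \<and>
        sqrt (R_plus (threshold \<alpha>) \<omega> h) - 2 * d \<le> critical_value m \<epsilon> \<alpha> h \<and>
        critical_value m \<epsilon> \<alpha> h \<le> sqrt (R_plus (threshold \<alpha>) \<omega> h) + 1"
      and coarse: "infsum (prior \<nu> \<omega>) {h\<in>scales. log 2 (1 / h) < sqrt \<omega>} \<le> e"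
      and exceed: "infsum (prior \<nu> \<omega>) {h\<in>scales. \<eta> * log_star \<omega> <
        (A \<omega> h / noise_level \<sigma> h - x)\<^sup>2 + \<eta> * log_star \<omega> - R_plus (threshold \<alpha>) \<omega> h} \<le> e"
      and p: "prob_dist_finite_entropy (prior \<nu> \<omega>)"
    have "Phi (- x - 2 * d) - 2 * e
        \<le> (\<Sum>\<^sub>\<infinity>h\<in>scales. prior \<nu> \<omega> h * Phi (critical_value m \<epsilon> \<alpha> h - A \<omega> h / noise_level \<sigma> h))"
    proof (rule prior_average_bounds(1)[OF p _ Phi_le_1 _ Phi_le_1 _ _ coarse exceed])
      fix h assume "h \<in> scales - {h\<in>scales. log 2 (1 / h) < sqrt \<omega>} - {h\<in>scales. \<eta> * log_star \<omega> <
        (A \<omega> h / noise_level \<sigma> h - x)\<^sup>2 + \<eta> * log_star \<omega> - R_plus (threshold \<alpha>) \<omega> h}"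
      then have h: "h \<in> scales" "sqrt \<omega> \<le> log 2 (1 / h)"
        and R: "(A \<omega> h / noise_level \<sigma> h - x)\<^sup>2 \<le> R_plus (threshold \<alpha>) \<omega> h"
        by auto
      have "A \<omega> h / noise_level \<sigma> h - x \<le> sqrt (R_plus (threshold \<alpha>) \<omega> h)"
        using R by (rule real_le_rsqrt)
      then show "Phi (- x - 2 * d) \<le> Phi (critical_value m \<epsilon> \<alpha> h - A \<omega> h / noise_level \<sigma> h)"
        using crit h by (intro Phi_mono) force
    qed (auto intro: less_imp_le Phi_pos)
    moreover have "Phi (- x - 2 * d) - 2 * e = y"
      by (simp add: e_def field_simps)
    ultimately show "y \<le> mean_type_II_error \<sigma> m \<epsilon> \<alpha> (prior \<nu> \<omega>) (A \<omega>)"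
      by (simp add: mean_type_II_error_eq[OF \<sigma> \<epsilon>])
  qed
qed

text \<open>With \<open>a = A \<omega> h / noise_level \<sigma> h\<close> and \<open>s = sqrt (\<eta> log_star \<omega>)\<close>, the bracket in the hypothesis
  is \<open>R_plus + s\<^sup>2 - (a - s)\<^sup>2\<close>. Where it is at most \<open>s\<^sup>2\<close>, the amplitude exceeds \<open>sqrt R_plus\<close> by at
  least \<open>s\<close>, because the other branch \<open>a \<le> s - sqrt R_plus\<close> would make \<open>a\<close> negative. The margin \<open>s\<close>
  tends to infinity.\<close>

lemma mean_type_II_error_vanishes:
  fixes A :: "real \<Rightarrow> real \<Rightarrow> real"
  assumes \<sigma>: "0 < \<sigma>" and \<epsilon>: "0 < \<epsilon>" "\<epsilon> < 1" and \<nu>: "admissible_density \<nu>"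
    and p: "\<forall>\<^sub>F \<omega> in at_top. prob_dist_finite_entropy (prior \<nu> \<omega>)" and \<eta>: "0 < \<eta>"
    and A: "\<forall>\<omega>>1. \<forall>h\<in>scales. 0 < A \<omega> h"
    and lim: "((\<lambda>\<omega>. ennreal (1 / log_star \<omega>) *
      expectation_pos_part (prior \<nu> \<omega>)
        (\<lambda>h. R_plus (threshold \<alpha>) \<omega> h + 2 * sqrt (\<eta> * log_star \<omega>) * (A \<omega> h / noise_level \<sigma> h)
          - (A \<omega> h)\<^sup>2 / (noise_level \<sigma> h)\<^sup>2)) \<longlongrightarrow> 0) at_top"
  shows "((\<lambda>\<omega>. mean_type_II_error \<sigma> m \<epsilon> \<alpha> (prior \<nu> \<omega>) (A \<omega>)) \<longlongrightarrow> 0) at_top"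
proof (rule order_tendstoI)
  fix y :: real assume "y < 0"
  moreover have "0 \<le> mean_type_II_error \<sigma> m \<epsilon> \<alpha> (prior \<nu> \<omega>) (A \<omega>)"
    if "prob_dist_finite_entropy (prior \<nu> \<omega>)" for \<omega>
    unfolding mean_type_II_error_eq[OF \<sigma> \<epsilon>] using that
    by (intro infsum_nonneg mult_nonneg_nonneg less_imp_le[OF Phi_pos]) (auto simp: prob_dist_finite_entropy_def)
  ultimately show "\<forall>\<^sub>F \<omega> in at_top. y < mean_type_II_error \<sigma> m \<epsilon> \<alpha> (prior \<nu> \<omega>) (A \<omega>)"
    using p by (auto elim!: eventually_mono intro: less_le_trans)
next
  fix y :: real assume "0 < y"
  \<comment> \<open>Three terms are at most \<open>e\<close>: the masses of two exceptional sets and the error off them.\<close>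
  define e where "e = y / 4"
  have e: "0 < e"
    using \<open>0 < y\<close> by (simp add: e_def)
  have "filterlim (\<lambda>\<omega>. 1 - sqrt (\<eta> * log_star \<omega>)) at_bot at_top"
    unfolding log_star_def using \<eta> by real_asymp
  then have "((\<lambda>\<omega>. Phi (1 - sqrt (\<eta> * log_star \<omega>))) \<longlongrightarrow> 0) at_top"
    by (rule filterlim_compose[OF Phi_at_bot])
  then have small: "\<forall>\<^sub>F \<omega> in at_top. Phi (1 - sqrt (\<eta> * log_star \<omega>)) < e"
    using e by (rule order_tendstoD(2))
  have radius: "\<forall>\<^sub>F \<omega> in at_top. \<eta> * log_star \<omega> \<le> (sqrt \<omega> - 1) * ln 2"
    unfolding log_star_def using \<eta> by real_asymp
  have L: "\<forall>\<^sub>F \<omega> in at_top. 0 \<le> log_star \<omega>"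
    unfolding log_star_def by real_asymp
  show "\<forall>\<^sub>F \<omega> in at_top. mean_type_II_error \<sigma> m \<epsilon> \<alpha> (prior \<nu> \<omega>) (A \<omega>) < y"
    using critical_value_asymptotics[OF \<epsilon> zero_less_one, of \<alpha> m] prior_coarse_scales[OF \<nu> p e]
      exceedance_mass_vanishes[OF lim p \<eta> e] p small radius L eventually_gt_at_top[of 1]
  proof eventually_elim
    fix \<omega> :: real
    assume crit: "\<forall>h\<in>scales. sqrt \<omega> \<le> log 2 (1 / h) \<longrightarrow>
        (sqrt \<omega> - 1) * ln 2 \<le> R_plus (threshold \<alpha>) \<omega> h \<and>
        sqrt (R_plus (threshold \<alpha>) \<omega> h) - 2 * 1 \<le> critical_value m \<epsilon> \<alpha> h \<and>
        critical_value m \<epsilon> \<alpha> h \<le> sqrt (R_plus (threshold \<alpha>) \<omega> h) + 1"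
      and coarse: "infsum (prior \<nu> \<omega>) {h\<in>scales. log 2 (1 / h) < sqrt \<omega>} \<le> e"
      and exceed: "infsum (prior \<nu> \<omega>) {h\<in>scales. \<eta> * log_star \<omega> <
        R_plus (threshold \<alpha>) \<omega> h + 2 * sqrt (\<eta> * log_star \<omega>) * (A \<omega> h / noise_level \<sigma> h)
          - (A \<omega> h)\<^sup>2 / (noise_level \<sigma> h)\<^sup>2} \<le> e"
      and p: "prob_dist_finite_entropy (prior \<nu> \<omega>)"
      and small: "Phi (1 - sqrt (\<eta> * log_star \<omega>)) < e"
      and radius: "\<eta> * log_star \<omega> \<le> (sqrt \<omega> - 1) * ln 2"
      and L: "0 \<le> log_star \<omega>" and \<omega>: "1 < \<omega>"
    define s where "s = sqrt (\<eta> * log_star \<omega>)"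
    have s2: "s\<^sup>2 = \<eta> * log_star \<omega>"
      using L \<eta> by (simp add: s_def)
    have "(\<Sum>\<^sub>\<infinity>h\<in>scales. prior \<nu> \<omega> h * Phi (critical_value m \<epsilon> \<alpha> h - A \<omega> h / noise_level \<sigma> h))
        \<le> Phi (1 - s) + 2 * e"
    proof (rule prior_average_bounds(2)[OF p _ Phi_le_1 _ Phi_le_1 _ _ coarse exceed])
      fix h assume "h \<in> scales - {h\<in>scales. log 2 (1 / h) < sqrt \<omega>} - {h\<in>scales. \<eta> * log_star \<omega> <
        R_plus (threshold \<alpha>) \<omega> h + 2 * sqrt (\<eta> * log_star \<omega>) * (A \<omega> h / noise_level \<sigma> h)
          - (A \<omega> h)\<^sup>2 / (noise_level \<sigma> h)\<^sup>2}"
      then have h: "h \<in> scales" "sqrt \<omega> \<le> log 2 (1 / h)"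
        and R: "R_plus (threshold \<alpha>) \<omega> h + 2 * s * (A \<omega> h / noise_level \<sigma> h)
          - (A \<omega> h)\<^sup>2 / (noise_level \<sigma> h)\<^sup>2 \<le> s\<^sup>2"
        unfolding s2 by (auto simp: not_less simp flip: s_def)
      define a where "a = A \<omega> h / noise_level \<sigma> h"
      define r where "r = R_plus (threshold \<alpha>) \<omega> h"
      have "0 < noise_level \<sigma> h"
        using \<sigma> scalesD(1)[OF h(1)] by (simp add: noise_level_def)
      then have a: "0 < a"
        using A \<omega> h(1) by (simp add: a_def)
      have "s\<^sup>2 \<le> r"
        using crit h radius by (force simp: s2 r_def)
      then have sr: "s \<le> sqrt r"
        by (rule real_le_rsqrt)
      have "r \<le> (a - s)\<^sup>2"
        using R by (simp add: a_def r_def power2_diff power_divide algebra_simps)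
      then have "sqrt r \<le> \<bar>a - s\<bar>"
        using real_sqrt_le_mono[of r "(a - s)\<^sup>2"] by simp
      then have "sqrt r \<le> a - s"
        using a sr by linarith
      moreover have "critical_value m \<epsilon> \<alpha> h \<le> sqrt r + 1"
        using crit h by (simp add: r_def)
      ultimately show "Phi (critical_value m \<epsilon> \<alpha> h - A \<omega> h / noise_level \<sigma> h) \<le> Phi (1 - s)"
        unfolding a_def[symmetric] by (intro Phi_mono) linarith
    qed (auto intro: less_imp_le Phi_pos)
    then show "mean_type_II_error \<sigma> m \<epsilon> \<alpha> (prior \<nu> \<omega>) (A \<omega>) < y"
      using small \<open>0 < y\<close> by (simp add: mean_type_II_error_eq[OF \<sigma> \<epsilon>] e_def s_def)
  qed
qed

theorem theorem5:
  fixes \<sigma> \<alpha> \<epsilon> :: real and m :: nat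
    and \<nu> :: "real \<Rightarrow> real" and A :: "real \<Rightarrow> real \<Rightarrow> real"
  assumes "0 < \<sigma>"
    and "0 < \<alpha>" "\<alpha> < 1"
    and "0 < \<epsilon>" "\<epsilon> < 1"
    and "1 \<le> m"
    and "admissible_density \<nu>"
    and "\<forall>\<^sub>F \<omega> in at_top. prob_dist_finite_entropy (prior \<nu> \<omega>)"
    and "\<forall>\<omega>>1. \<forall>h\<in>scales. 0 < A \<omega> h"
  shows
    "(\<forall>x \<eta> :: real. 0 < \<eta> \<longrightarrow>
        ((\<lambda>\<omega>. ennreal (1 / log_star \<omega>) *
            expectation_pos_part (prior \<nu> \<omega>)
              (\<lambda>h. (A \<omega> h / noise_level \<sigma> h - x)\<^sup>2 + \<eta> * log_star \<omega>
                    - R_plus (threshold \<alpha>) \<omega> h)) \<longlongrightarrow> 0) at_top \<longrightarrow>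
        Liminf at_top (\<lambda>\<omega>. ereal (mean_type_II_error \<sigma> m \<epsilon> \<alpha> (prior \<nu> \<omega>) (A \<omega>)))
          \<ge> ereal ((1 - \<alpha>) * (1 - Phi x))) \<and>
     (\<forall>\<eta> :: real. 0 < \<eta> \<longrightarrow>
        ((\<lambda>\<omega>. ennreal (1 / log_star \<omega>) *
            expectation_pos_part (prior \<nu> \<omega>)
              (\<lambda>h. R_plus (threshold \<alpha>) \<omega> h
                    + 2 * sqrt (\<eta> * log_star \<omega>) * (A \<omega> h / noise_level \<sigma> h)
                    - (A \<omega> h)\<^sup>2 / (noise_level \<sigma> h)\<^sup>2)) \<longlongrightarrow> 0) at_top \<longrightarrow>
        ((\<lambda>\<omega>. mean_type_II_error \<sigma> m \<epsilon> \<alpha> (prior \<nu> \<omega>) (A \<omega>)) \<longlongrightarrow> 0) at_top)"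
proof (intro conjI allI impI)
  fix x \<eta> :: real
  assume \<eta>: "0 < \<eta>"
    and lim: "((\<lambda>\<omega>. ennreal (1 / log_star \<omega>) *
      expectation_pos_part (prior \<nu> \<omega>)
        (\<lambda>h. (A \<omega> h / noise_level \<sigma> h - x)\<^sup>2 + \<eta> * log_star \<omega> - R_plus (threshold \<alpha>) \<omega> h)) \<longlongrightarrow> 0) at_top"
  \<comment> \<open>The strict inequality leaves room for the shift by \<open>2 * d\<close> in the lower bound.\<close>
  have "(1 - \<alpha>) * (1 - Phi x) < Phi (- x)"
    using assms(2,3) Phi_pos[of "- x"] by (simp add: algebra_simps flip: Phi_uminus)
  then have "\<forall>\<^sub>F \<omega> in at_top. (1 - \<alpha>) * (1 - Phi x) \<le> mean_type_II_error \<sigma> m \<epsilon> \<alpha> (prior \<nu> \<omega>) (A \<omega>)"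
    by (rule mean_type_II_error_lower[OF assms(1,4,5,7,8) \<eta> lim])
  then show "ereal ((1 - \<alpha>) * (1 - Phi x))
      \<le> Liminf at_top (\<lambda>\<omega>. ereal (mean_type_II_error \<sigma> m \<epsilon> \<alpha> (prior \<nu> \<omega>) (A \<omega>)))"
    by (intro Liminf_bounded) simp
next
  fix \<eta> :: real
  assume "0 < \<eta>"
    and "((\<lambda>\<omega>. ennreal (1 / log_star \<omega>) *
      expectation_pos_part (prior \<nu> \<omega>)
        (\<lambda>h. R_plus (threshold \<alpha>) \<omega> h + 2 * sqrt (\<eta> * log_star \<omega>) * (A \<omega> h / noise_level \<sigma> h)
          - (A \<omega> h)\<^sup>2 / (noise_level \<sigma> h)\<^sup>2)) \<longlongrightarrow> 0) at_top"
  then show "((\<lambda>\<omega>. mean_type_II_error \<sigma> m \<epsilon> \<alpha> (prior \<nu> \<omega>) (A \<omega>)) \<longlongrightarrow> 0) at_top"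
    by (rule mean_type_II_error_vanishes[OF assms(1,4,5,7,8) _ assms(9)])
qed

end
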